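(* It is not decidable, given an element $f\in 2V$ and two dyadic points $p,q\in C^2$, whether the orbit of $p$ under $f$ converges to $q$.
   Context: Let $C=\{0,1\}^\infty$ be the Cantor set of infinite binary sequences (with the product topology) and $\{0,1\}^*$ the set of finite binary sequences. For $\alpha,\beta\in\{0,1\}^*$ let $I(\alpha)=\{\alpha\omega\mid\omega\in\{0,1\}^\infty\}$ and let $R(\alpha,\beta)=I(\alpha)\times I(\beta)\subseteq C^2=C\times C$; such sets $R(\alpha,\beta)$ are called dyadic rectangles. A dyadic subdivision of $C^2$ is a partition of $C^2$ into finitely many dyadic rectangles. The prefix replacement function $R(\alpha,\beta)\to R(\gamma,\delta)$ is $(\alpha\psi,\beta\omega)\mapsto(\gamma\psi,\delta\omega)$ for $\psi,\omega\in\{0,1\}^\infty$. The Brin-Thompson group $2V$ is the group of all homeomorphisms $f\colon C^2\to C^2$ for which there is a dyadic subdivision of $C^2$ such that $f$ acts as a prefix replacement (onto some dyadic rectangle) on each of its rectangles. An element $f\in 2V$ is given to an algorithm as a finite list of pairs (domain rectangle, image rectangle), i.e. a domain dyadic subdivision, a range dyadic subdivision and a bijection between them. A point $(\psi,\omega)\in C^2$ is dyadic if $\psi$ and $\omega$ each have only finitely many $1$'s; it is given to an algorithm by finite prefixes of $\psi$ and $\omega$ after which only $0$'s occur. The orbit of $p$ under $f$ is the sequence $p,f(p),f^2(p),\ldots$. *)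

theory Defs
  imports
    "HOL-Analysis.Analysis"
    "HOL-Library.Omega_Words_Fun"
    "HOL-Library.Disjoint_Sets"
    "HOL-Library.Nat_Bijection"
begin

section \<open>Partial recursive functions and decidability\<close>

text \<open>
  Terms for Kleene's partial recursive functions: the basic functions closed under
  composition, primitive recursion (on the first argument) and unbounded minimisation.
\<close>

datatype recf =
    Zero
  | Succ
  | Proj nat
  | Comp recf "recf list"
  | PrimRec recf recf
  | Mu recf

text \<open>
  \<open>computes A xs y\<close> means that the partial function denoted by \<open>A\<close> is defined at the
  argument tuple \<open>xs\<close> and has value \<open>y\<close>. Arities are not recorded in the terms; a term applied
  to a tuple of a length that it cannot handle is undefined there. A minimisation
  is only defined if all values before the first zero are defined.
\<close>

inductive computes :: "recf \<Rightarrow> nat list \<Rightarrow> nat \<Rightarrow> bool" where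
  zero: "computes Zero xs 0"
| succ: "computes Succ [n] (Suc n)"
| proj: "i < length xs \<Longrightarrow> computes (Proj i) xs (xs ! i)"
| comp: "list_all2 (\<lambda>G y. computes G xs y) Gs ys \<Longrightarrow> computes F ys z
    \<Longrightarrow> computes (Comp F Gs) xs z"
| prim_0: "computes F xs y \<Longrightarrow> computes (PrimRec F G) (0 # xs) y"
| prim_Suc: "computes (PrimRec F G) (n # xs) y \<Longrightarrow> computes G (n # y # xs) z
    \<Longrightarrow> computes (PrimRec F G) (Suc n # xs) z"
| mu: "computes F (n # xs) 0 \<Longrightarrow> (\<And>m. m < n \<Longrightarrow> \<exists>y. computes F (m # xs) (Suc y))
    \<Longrightarrow> computes (Mu F) xs n"

inductive_cases computes_ZeroE: "computes Zero xs y"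
inductive_cases computes_SuccE: "computes Succ xs y"
inductive_cases computes_ProjE: "computes (Proj i) xs y"
inductive_cases computes_CompE: "computes (Comp F Gs) xs y"
inductive_cases computes_PrimRec0E: "computes (PrimRec F G) (0 # xs) y"
inductive_cases computes_PrimRecSucE: "computes (PrimRec F G) (Suc n # xs) y"
inductive_cases computes_MuE: "computes (Mu F) xs y"

lemma computes_unique:
  assumes "computes A xs y" and "computes A xs z"
  shows "y = z"
  using assms
proof (induction arbitrary: z rule: computes.induct)
  case (zero xs)
  then show ?case by (auto elim: computes_ZeroE)
next
  case (succ n)
  then show ?case by (auto elim: computes_SuccE)
next
  case (proj i xs)
  then show ?case by (auto elim: computes_ProjE)
next
  case (comp xs Gs ys F w)
  from comp.prems obtain ys' where
    ys': "list_all2 (\<lambda>G y. computes G xs y) Gs ys'" "computes F ys' z"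
    by (rule computes_CompE)
  have "ys = ys'"
  proof (rule nth_equalityI)
    show len: "length ys = length ys'"
      using list_all2_lengthD[OF comp.IH(1)] list_all2_lengthD[OF ys'(1)] by (rule trans[OF sym])
    fix i assume "i < length ys"
    with len have i': "i < length ys'" by (rule subst)
    have "computes (Gs ! i) xs (ys' ! i)"
      using list_all2_nthD2[OF ys'(1) i'] .
    with list_all2_nthD2[OF comp.IH(1) \<open>i < length ys\<close>] show "ys ! i = ys' ! i"
      by (elim conjE allE impE)
  qed
  with ys'(2) have "computes F ys z" by (simp only:)
  then show ?case by (rule comp.IH(2))
next
  case (prim_0 F xs y G)
  from prim_0.prems have "computes F xs z" by (rule computes_PrimRec0E)
  then show ?case by (rule prim_0.IH)
next
  case (prim_Suc F G n xs y w)
  from prim_Suc.prems obtain y' where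
    y': "computes (PrimRec F G) (n # xs) y'" "computes G (n # y' # xs) z"
    by (rule computes_PrimRecSucE)
  from prim_Suc.IH(1)[OF y'(1)] y'(2) have "computes G (n # y # xs) z"
    by simp
  then show ?case by (rule prim_Suc.IH(2))
next
  case (mu F n xs)
  from mu.prems have z: "computes F (z # xs) 0"
    "\<And>m. m < z \<Longrightarrow> \<exists>y. computes F (m # xs) (Suc y)"
    by (blast elim: computes_MuE)+
  have "\<not> z < n"
  proof
    assume "z < n"
    from mu.IH(2)[OF this] obtain y where
      y: "\<forall>w. computes F (z # xs) w \<longrightarrow> Suc y = w" by (elim exE conjE)
    from y[rule_format, OF z(1)] show False by (rule Suc_neq_Zero)
  qed
  moreover have "\<not> n < z"
  proof
    assume "n < z"
    then obtain y where "computes F (n # xs) (Suc y)" using z(2) by blast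
    then have "0 = Suc y" by (rule mu.IH(1))
    then show False by simp
  qed
  ultimately show ?case by simp
qed

text \<open>
  Decidability of a property \<open>P\<close> of the objects in \<open>X\<close>, where an object \<open>x\<close> is given to the
  algorithm by any description \<open>d\<close> with \<open>describes d x\<close>, and \<open>code\<close> turns descriptions into
  natural numbers. The algorithm has to halt with the correct answer on every valid
  description; nothing is required on other inputs.
\<close>

definition decidable_given ::
    "('d \<Rightarrow> nat) \<Rightarrow> ('d \<Rightarrow> 'x \<Rightarrow> bool) \<Rightarrow> 'x set \<Rightarrow> ('x \<Rightarrow> bool) \<Rightarrow> bool" where
  "decidable_given code describes X P \<longleftrightarrow>
    (\<exists>A. \<forall>x\<in>X. \<forall>d. describes d x \<longrightarrow> computes A [code d] (if P x then 1 else 0))"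

section \<open>Cantor square and the Brin-Thompson group 2V\<close>

text \<open>
  The digit 1 is \<open>True\<close> and 0 is \<open>False\<close>. The instances for \<open>bool\<close> (discrete), functions and
  pairs make the type class topology of \<open>cantor \<times> cantor\<close> the product topology.
\<close>

type_synonym cantor = "bool word"
type_synonym rect = "bool list \<times> bool list"

definition cone :: "bool list \<Rightarrow> cantor set" where
  "cone \<alpha> = {\<alpha> \<frown> \<omega> | \<omega>. True}"

definition rectangle :: "rect \<Rightarrow> (cantor \<times> cantor) set" where
  "rectangle r = cone (fst r) \<times> cone (snd r)"

definition dyadic_subdivision :: "(cantor \<times> cantor) set set \<Rightarrow> bool" where
  "dyadic_subdivision P \<longleftrightarrow> finite P \<and> P \<subseteq> range rectangle \<and> partition_on UNIV P"

definition prefix_replacement ::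
    "(cantor \<times> cantor \<Rightarrow> cantor \<times> cantor) \<Rightarrow> rect \<Rightarrow> rect \<Rightarrow> bool" where
  "prefix_replacement f d r \<longleftrightarrow>
    (\<forall>\<psi> \<omega>. f (fst d \<frown> \<psi>, snd d \<frown> \<omega>) = (fst r \<frown> \<psi>, snd r \<frown> \<omega>))"

definition brin_thompson_2V :: "(cantor \<times> cantor \<Rightarrow> cantor \<times> cantor) set" where
  "brin_thompson_2V = {f. (\<exists>g. homeomorphism UNIV UNIV f g) \<and>
    (\<exists>P. dyadic_subdivision P \<and>
      (\<forall>X\<in>P. \<exists>d r. X = rectangle d \<and> prefix_replacement f d r))}"

definition dyadic_point :: "cantor \<times> cantor \<Rightarrow> bool" where
  "dyadic_point p \<longleftrightarrow> finite {n. fst p n} \<and> finite {n. snd p n}"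

section \<open>Finite descriptions of elements and points\<close>

definition describes_element ::
    "(rect \<times> rect) list \<Rightarrow> (cantor \<times> cantor \<Rightarrow> cantor \<times> cantor) \<Rightarrow> bool" where
  "describes_element L f \<longleftrightarrow>
    distinct (map fst L) \<and> dyadic_subdivision (rectangle ` fst ` set L) \<and>
    distinct (map snd L) \<and> dyadic_subdivision (rectangle ` snd ` set L) \<and>
    (\<forall>(d, r)\<in>set L. prefix_replacement f d r)"

definition describes_point :: "bool list \<times> bool list \<Rightarrow> cantor \<times> cantor \<Rightarrow> bool" where
  "describes_point u p \<longleftrightarrow> p = (fst u \<frown> (\<lambda>_. False), snd u \<frown> (\<lambda>_. False))"

text \<open>
  The codings below are injective and explicit; an arbitrary injection into \<open>nat\<close>, such
  as \<open>to_nat\<close> of class \<open>countable\<close>, need not be computable.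
\<close>

definition code_word :: "bool list \<Rightarrow> nat" where
  "code_word w = list_encode (map of_bool w)"

definition code_pair :: "bool list \<times> bool list \<Rightarrow> nat" where
  "code_pair u = prod_encode (code_word (fst u), code_word (snd u))"

definition code_element :: "(rect \<times> rect) list \<Rightarrow> nat" where
  "code_element L = list_encode (map (\<lambda>(d, r). prod_encode (code_pair d, code_pair r)) L)"

type_synonym description =
  "(rect \<times> rect) list \<times> (bool list \<times> bool list) \<times> (bool list \<times> bool list)"

definition code_instance :: "description \<Rightarrow> nat" where
  "code_instance = (\<lambda>(L, u, v).
    prod_encode (code_element L, prod_encode (code_pair u, code_pair v)))"

definition describes_instance ::
    "description \<Rightarrow> (cantor \<times> cantor \<Rightarrow> cantor \<times> cantor) \<times> (cantor \<times> cantor) \<times> (cantor \<times> cantor)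
      \<Rightarrow> bool" where
  "describes_instance = (\<lambda>(L, u, v) (f, p, q).
    describes_element L f \<and> describes_point u p \<and> describes_point v q)"

end

theory Submission
  imports Defs
begin

text \<open>
  Suppose that \<open>A\<close> decides convergence of orbits. The theorem follows by diagonalisation from one
  construction: every partial recursive function \<open>F\<close> of one argument can be built into an element
  \<open>f\<close> of 2V such that, from a dyadic point that displays the number \<open>x\<close> in unary, the orbit
  of \<open>f\<close> simulates the evaluation of \<open>F\<close> at \<open>x\<close>, and then converges to one of two
  different points that depend only on whether the value is zero (\<open>recf_value_decides_limit\<close>).
  The input points and the two limits do not depend on \<open>F\<close>.
  Take for \<open>F\<close> the function that sends \<open>x\<close> to the answer of \<open>A\<close> for the element with code
  \<open>x\<close>, the input point of \<open>x\<close>, and the limit that belongs to the value zero; this is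
  recursive because the code of the input point is computed from \<open>x\<close> by primitive recursion.
  On the code of the element built from \<open>F\<close> itself, the answer "yes" is the value 1 and sends the
  orbit to the other limit, while "no" is the value 0 and sends it to the limit in question.
  The element may depend on \<open>F\<close> in any way whatsoever, because \<open>F\<close> receives its code as an
  input; and as \<open>A\<close> answers on every valid description, the runs to be simulated all halt.

  The construction has three layers. First, \<open>F\<close> is turned into a program with increments,
  decrements and while loops on finitely many registers (\<open>recf_compilable\<close>).
  Second, the program is run on two stacks, the two coordinates of a point. The
  right one holds the registers as blocks of ones, each closed by a zero. A command walks out to its
  register by shifting bits to the left stack, acts there, and walks back. Such a step is a prefix
  replacement of both coordinates, but a program is not injective. Therefore each command,
  once completed, leaves a record of itself on the left stack, so that distinct rules have disjoint
  images (\<open>machine_reversible\<close>). Third, finitely many prefix replacements between rectangles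
  with disjoint domains and disjoint images extend to an element of 2V on two copies of the square: one
  copy runs the rules forwards, the other runs them backwards, and a point at which a copy has no
  rule passes to the other copy (\<open>injective_rules_in_2V\<close>).

  A homeomorphism never reaches a fixed point from another point. So a halted run
  is not stopped but enters a rectangle that is contracted to a point in every further step
  (\<open>sink_converges\<close>).
\<close>

section \<open>Programs for partial recursive functions\<close>

datatype cmd = Inc nat | Dec nat | While nat "cmd list"

fun reg :: "cmd \<Rightarrow> nat" where
  "reg (Inc r) = r" | "reg (Dec r) = r" | "reg (While r B) = r"

fun update :: "cmd \<Rightarrow> nat \<Rightarrow> nat" where
  "update (Inc r) n = Suc n" | "update (Dec r) n = n - 1" | "update (While r B) n = n"

text \<open>
  The list of commands still to be executed serves as the control state of a run, in place of a
  program counter. The flag tells whether the register of the first command is nonzero.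
\<close>

fun continuation :: "cmd list \<Rightarrow> bool \<Rightarrow> cmd list" where
  "continuation (While r B # K) True = B @ While r B # K"
| "continuation (c # K) _ = K"
| "continuation [] _ = []"

text \<open>
  A derivation of \<open>exec P \<sigma> \<tau>\<close> has one rule application per step of the run, so that the
  simulation by a machine is an induction over derivations.
\<close>

inductive exec :: "cmd list \<Rightarrow> (nat \<Rightarrow> nat) \<Rightarrow> (nat \<Rightarrow> nat) \<Rightarrow> bool" where
  exec_Nil: "exec [] \<sigma> \<sigma>"
| exec_Cons: "exec (continuation (c # K) (\<sigma> (reg c) \<noteq> 0)) (\<sigma>(reg c := update c (\<sigma> (reg c)))) \<tau>
    \<Longrightarrow> exec (c # K) \<sigma> \<tau>"

lemma continuation_append: "continuation ((c # K) @ K') b = continuation (c # K) b @ K'"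
  by (cases c; cases b) auto

lemma exec_append:
  assumes "exec P \<sigma> \<tau>" and "exec Q \<tau> \<rho>"
  shows "exec (P @ Q) \<sigma> \<rho>"
  using assms
proof (induction rule: exec.induct)
  case (exec_Cons c K \<sigma> \<tau>)
  then show ?case
    using exec.exec_Cons[where c = c and K = "K @ Q" and \<sigma> = \<sigma> and \<tau> = \<rho>]
    by (simp add: continuation_append[of c K Q, simplified] del: fun_upd_apply)
qed simp

lemma exec_Inc: "exec [Inc r] \<sigma> (\<sigma>(r := Suc (\<sigma> r)))"
  using exec_Cons[where c = "Inc r" and K = "[]" and \<sigma> = \<sigma>] by (simp add: exec_Nil)

lemma exec_Dec: "exec [Dec r] \<sigma> (\<sigma>(r := \<sigma> r - 1))"
  using exec_Cons[where c = "Dec r" and K = "[]" and \<sigma> = \<sigma>] by (simp add: exec_Nil)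

lemma exec_While_0: "\<sigma> r = 0 \<Longrightarrow> exec [While r B] \<sigma> \<sigma>"
  using exec_Cons[where c = "While r B" and K = "[]" and \<sigma> = \<sigma>] by (simp add: exec_Nil fun_upd_idem)

lemma exec_While_Suc:
  assumes "\<sigma> r \<noteq> 0" and "exec B \<sigma> \<rho>" and "exec [While r B] \<rho> \<tau>"
  shows "exec [While r B] \<sigma> \<tau>"
  using exec_Cons[where c = "While r B" and K = "[]" and \<sigma> = \<sigma>] exec_append[OF assms(2,3)] assms(1) by simp

definition clear :: "nat \<Rightarrow> cmd list" where
  "clear r = [While r [Dec r]]"

text \<open>
  The register \<open>s\<close> can only be read by emptying it; \<open>t\<close> keeps the value from which
  \<open>s\<close> is restored.
\<close>

definition copy :: "nat \<Rightarrow> nat \<Rightarrow> nat \<Rightarrow> cmd list" where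
  "copy s d t = clear d @ clear t @ [While s [Dec s, Inc d, Inc t]] @ [While t [Dec t, Inc s]]"

lemma exec_clear: "exec (clear r) \<sigma> (\<sigma>(r := 0))"
  unfolding clear_def
proof (induction "\<sigma> r" arbitrary: \<sigma>)
  case 0
  then show ?case using exec_While_0[of \<sigma> r] by (simp add: fun_upd_idem)
next
  case (Suc n)
  have "exec [While r [Dec r]] (\<sigma>(r := n)) (\<sigma>(r := 0))"
    using Suc(1)[of "\<sigma>(r := n)"] by simp
  then show ?case using exec_While_Suc[of \<sigma> r "[Dec r]"] exec_Dec[of r \<sigma>] Suc(2)[symmetric] by simp
qed

lemma exec_copy:
  assumes "s \<noteq> d" "s \<noteq> t" "d \<noteq> t"
  shows "exec (copy s d t) \<sigma> (\<sigma>(d := \<sigma> s, t := 0))"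
proof -
  have split: "exec [While s [Dec s, Inc d, Inc t]] \<sigma> (\<sigma>(s := 0, d := \<sigma> d + \<sigma> s, t := \<sigma> t + \<sigma> s))" for \<sigma>
  proof (induction "\<sigma> s" arbitrary: \<sigma>)
    case 0
    then show ?case using exec_While_0[of \<sigma> s] by (simp add: fun_upd_idem)
  next
    case (Suc n)
    let ?\<rho> = "\<sigma>(s := n, d := Suc (\<sigma> d), t := Suc (\<sigma> t))"
    have "exec [Dec s, Inc d, Inc t] \<sigma> ?\<rho>"
      using exec_append[OF exec_Dec[of s \<sigma>] exec_append[OF exec_Inc[of d] exec_Inc[of t]]] Suc(2)[symmetric] assms
      by simp
    moreover have "exec [While s [Dec s, Inc d, Inc t]] ?\<rho> (\<sigma>(s := 0, d := \<sigma> d + \<sigma> s, t := \<sigma> t + \<sigma> s))"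
      by (rule back_subst[of "exec _ _", OF Suc(1)[of ?\<rho>]])
        (use Suc(2)[symmetric] assms in \<open>auto simp: fun_eq_iff\<close>)
    ultimately show ?case using exec_While_Suc[of \<sigma> s] Suc(2) by simp
  qed
  have restore: "exec [While t [Dec t, Inc s]] \<sigma> (\<sigma>(s := \<sigma> s + \<sigma> t, t := 0))" for \<sigma>
  proof (induction "\<sigma> t" arbitrary: \<sigma>)
    case 0
    then show ?case using exec_While_0[of \<sigma> t] by (simp add: fun_upd_idem)
  next
    case (Suc n)
    let ?\<rho> = "\<sigma>(t := n, s := Suc (\<sigma> s))"
    have "exec [Dec t, Inc s] \<sigma> ?\<rho>"
      using exec_append[OF exec_Dec[of t \<sigma>] exec_Inc[of s]] Suc(2)[symmetric] assms by simp
    moreover have "exec [While t [Dec t, Inc s]] ?\<rho> (\<sigma>(s := \<sigma> s + \<sigma> t, t := 0))"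
      by (rule back_subst[of "exec _ _", OF Suc(1)[of ?\<rho>]])
        (use Suc(2)[symmetric] assms in \<open>auto simp: fun_eq_iff\<close>)
    ultimately show ?case using exec_While_Suc[of \<sigma> t] Suc(2) by simp
  qed
  let ?\<rho> = "\<sigma>(d := 0, t := 0)"
  have "exec (copy s d t) \<sigma> ((?\<rho>(s := 0, d := ?\<rho> d + ?\<rho> s, t := ?\<rho> t + ?\<rho> s))(s := \<sigma> s, t := 0))"
    unfolding copy_def
    using exec_append[OF exec_clear[of d \<sigma>] exec_append[OF exec_clear[of t] exec_append[OF split restore]]] assms
    by simp
  moreover have "(?\<rho>(s := 0, d := ?\<rho> d + ?\<rho> s, t := ?\<rho> t + ?\<rho> s))(s := \<sigma> s, t := 0)
    = \<sigma>(d := \<sigma> s, t := 0)"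
    using assms by (auto simp: fun_eq_iff)
  ultimately show ?thesis by (simp only:)
qed

definition ends_in :: "cmd list \<Rightarrow> (nat \<Rightarrow> nat) \<Rightarrow> ((nat \<Rightarrow> nat) \<Rightarrow> bool) \<Rightarrow> bool" where
  "ends_in P \<sigma> \<Phi> \<longleftrightarrow> (\<exists>\<tau>. exec P \<sigma> \<tau> \<and> \<Phi> \<tau>)"

lemma ends_in_append:
  assumes "ends_in P \<sigma> \<Phi>" and "\<And>\<rho>. \<Phi> \<rho> \<Longrightarrow> ends_in Q \<rho> \<Psi>"
  shows "ends_in (P @ Q) \<sigma> \<Psi>"
  using assms exec_append unfolding ends_in_def by blast

lemma ends_in_Nil: "\<Phi> \<sigma> \<Longrightarrow> ends_in [] \<sigma> \<Phi>"
  unfolding ends_in_def using exec_Nil by blast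

lemma ends_in_exec: "exec P \<sigma> \<tau> \<Longrightarrow> \<Phi> \<tau> \<Longrightarrow> ends_in P \<sigma> \<Phi>"
  unfolding ends_in_def by blast

definition writes :: "nat \<Rightarrow> nat \<Rightarrow> nat \<Rightarrow> (nat \<Rightarrow> nat) \<Rightarrow> (nat \<Rightarrow> nat) \<Rightarrow> bool" where
  "writes k out y \<sigma> \<tau> \<longleftrightarrow> \<tau> out = y \<and> (\<forall>j<k. j \<noteq> out \<longrightarrow> \<tau> j = \<sigma> j)"

text \<open>
  Registers from \<open>k\<close> on are scratch space: the program may start with arbitrary contents there
  and may leave arbitrary contents behind. Hence every scratch register is cleared or
  overwritten before it is read, and nothing has to be cleaned up between subprograms.
\<close>

definition evaluates :: "cmd list \<Rightarrow> recf \<Rightarrow> nat list \<Rightarrow> nat \<Rightarrow> nat \<Rightarrow> bool" where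
  "evaluates P F args out k \<longleftrightarrow>
    (\<forall>\<sigma> y. computes F (map \<sigma> args) y \<longrightarrow> ends_in P \<sigma> (writes k out y \<sigma>))"

definition compilable :: "recf \<Rightarrow> bool" where
  "compilable F \<longleftrightarrow> (\<forall>args out k. set args \<subseteq> {..<k} \<longrightarrow> out < k \<longrightarrow> out \<notin> set args
    \<longrightarrow> (\<exists>P. evaluates P F args out k))"

lemma compilableD:
  assumes "compilable F" "set args \<subseteq> {..<k}" "out < k" "out \<notin> set args"
  obtains P where "evaluates P F args out k"
  using assms unfolding compilable_def by blast

lemma evaluatesD:
  assumes "evaluates P F args out k" "computes F (map \<sigma> args) y"
  shows "ends_in P \<sigma> (writes k out y \<sigma>)"
  using assms unfolding evaluates_def by blast

lemma ends_in_clear: "\<Phi> (\<sigma>(r := 0)) \<Longrightarrow> ends_in (clear r) \<sigma> \<Phi>"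
  by (rule ends_in_exec[OF exec_clear])

lemma ends_in_copy:
  "\<lbrakk>s \<noteq> d; s \<noteq> t; d \<noteq> t; \<Phi> (\<sigma>(d := \<sigma> s, t := 0))\<rbrakk> \<Longrightarrow> ends_in (copy s d t) \<sigma> \<Phi>"
  by (rule ends_in_exec[OF exec_copy])

lemma compilable_Zero: "compilable Zero"
  unfolding compilable_def evaluates_def
proof (intro allI impI exI)
  fix args :: "nat list" and out k :: nat and \<sigma> y
  assume "computes Zero (map \<sigma> args) y"
  then show "ends_in (clear out) \<sigma> (writes k out y \<sigma>)"
    by (intro ends_in_clear) (auto elim: computes_ZeroE simp: writes_def)
qed

lemma compilable_Succ: "compilable Succ"
  unfolding compilable_def evaluates_def
proof (intro allI impI exI)
  fix args :: "nat list" and out k :: nat and \<sigma> y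
  assume *: "set args \<subseteq> {..<k}" "out < k" "out \<notin> set args" and "computes Succ (map \<sigma> args) y"
  then obtain i where "args = [i]" "y = Suc (\<sigma> i)" by (auto elim: computes_SuccE)
  with * have "exec (copy i out k @ [Inc out]) \<sigma> (\<sigma>(k := 0, out := y))"
    using exec_append[OF exec_copy[of i out k \<sigma>] exec_Inc[of out]] by (auto simp: fun_upd_twist)
  with * \<open>args = [i]\<close> show "ends_in (copy (hd args) out k @ [Inc out]) \<sigma> (writes k out y \<sigma>)"
    by (auto intro!: ends_in_exec simp: writes_def)
qed

lemma compilable_Proj: "compilable (Proj i)"
  unfolding compilable_def evaluates_def
proof (intro allI impI exI)
  fix args :: "nat list" and out k :: nat and \<sigma> y
  assume *: "set args \<subseteq> {..<k}" "out < k" "out \<notin> set args"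
    and "computes (Proj i) (map \<sigma> args) y"
  then have i: "i < length args" "y = \<sigma> (args ! i)" by (auto elim: computes_ProjE)
  then have "args ! i \<in> set args" by simp
  with * have "args ! i < k" "args ! i \<noteq> out" by auto
  with * i show "ends_in (copy (args ! i) out k) \<sigma> (writes k out y \<sigma>)"
    by (intro ends_in_copy) (auto simp: writes_def)
qed

text \<open>
  The values of several functions at the same arguments go to the consecutive registers
  \<open>m, m + 1, \<dots>\<close>. While one value is computed, the earlier ones are protected by
  lying below the bound on the scratch space.
\<close>

lemma evaluate_all:
  assumes "\<And>G. G \<in> set Gs \<Longrightarrow> compilable G" and "set args \<subseteq> {..<k}" "k \<le> m"
  shows "\<exists>P. \<forall>\<sigma> ys. list_all2 (\<lambda>G y. computes G (map \<sigma> args) y) Gs ys \<longrightarrow>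
    ends_in P \<sigma> (\<lambda>\<tau>. map \<tau> [m..<m + length Gs] = ys \<and> (\<forall>j<m. \<tau> j = \<sigma> j))"
  using assms
proof (induction Gs arbitrary: m)
  case Nil
  then show ?case by (intro exI[of _ "[]"]) (auto intro: ends_in_Nil)
next
  case (Cons G Gs)
  from Cons.prems obtain P where P: "evaluates P G args m (Suc m)"
    by (elim compilableD[of G args "Suc m" m, rotated -1]) (auto simp: subset_eq)
  from Cons.IH[of "Suc m"] Cons.prems obtain Q where
    Q: "\<And>\<sigma> ys. list_all2 (\<lambda>G y. computes G (map \<sigma> args) y) Gs ys \<Longrightarrow>
      ends_in Q \<sigma> (\<lambda>\<tau>. map \<tau> [Suc m..<Suc m + length Gs] = ys \<and> (\<forall>j<Suc m. \<tau> j = \<sigma> j))"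
    by auto
  show ?case
  proof (intro exI allI impI)
    fix \<sigma> ys
    assume "list_all2 (\<lambda>G y. computes G (map \<sigma> args) y) (G # Gs) ys"
    then obtain z zs where ys: "ys = z # zs" "computes G (map \<sigma> args) z"
      "list_all2 (\<lambda>G y. computes G (map \<sigma> args) y) Gs zs" by (auto simp: list_all2_Cons1)
    show "ends_in (P @ Q) \<sigma> (\<lambda>\<tau>. map \<tau> [m..<m + length (G # Gs)] = ys \<and> (\<forall>j<m. \<tau> j = \<sigma> j))"
    proof (rule ends_in_append[OF evaluatesD[OF P ys(2)]])
      fix \<rho> assume \<rho>: "writes (Suc m) m z \<sigma> \<rho>"
      then have "map \<rho> args = map \<sigma> args" using Cons.prems by (auto simp: writes_def subset_eq)
      with Q[of \<rho> zs] ys(3) have "ends_in Q \<rho>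
        (\<lambda>\<tau>. map \<tau> [Suc m..<Suc m + length Gs] = zs \<and> (\<forall>j<Suc m. \<tau> j = \<rho> j))" by simp
      then show "ends_in Q \<rho> (\<lambda>\<tau>. map \<tau> [m..<m + length (G # Gs)] = ys \<and> (\<forall>j<m. \<tau> j = \<sigma> j))"
        unfolding ends_in_def
      proof (elim exE conjE, intro exI conjI)
        fix \<tau>
        assume \<tau>: "map \<tau> [Suc m..<Suc m + length Gs] = zs" "\<forall>j<Suc m. \<tau> j = \<rho> j"
        have "[m..<m + length (G # Gs)] = m # [Suc m..<Suc m + length Gs]"
          by (simp add: upt_conv_Cons del: upt_Suc)
        then show "map \<tau> [m..<m + length (G # Gs)] = ys" using \<tau> \<rho> by (simp add: ys(1) writes_def)
        show "\<forall>j<m. \<tau> j = \<sigma> j" using \<tau> \<rho> by (simp add: writes_def)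
      qed
    qed
  qed
qed

lemma compilable_Comp:
  assumes "compilable F" and "\<And>G. G \<in> set Gs \<Longrightarrow> compilable G"
  shows "compilable (Comp F Gs)"
  unfolding compilable_def
proof (intro allI impI)
  fix args :: "nat list" and out k :: nat
  assume *: "set args \<subseteq> {..<k}" "out < k" "out \<notin> set args"
  obtain P where P: "\<And>\<sigma> ys. list_all2 (\<lambda>G y. computes G (map \<sigma> args) y) Gs ys \<Longrightarrow>
    ends_in P \<sigma> (\<lambda>\<tau>. map \<tau> [k..<k + length Gs] = ys \<and> (\<forall>j<k. \<tau> j = \<sigma> j))"
    using evaluate_all[OF assms(2) *(1) order_refl] by blast
  obtain Q where Q: "evaluates Q F [k..<k + length Gs] out (k + length Gs)"
    using * by (elim compilableD[OF assms(1), of "[k..<k + length Gs]" "k + length Gs" out, rotated -1]) auto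
  have "evaluates (P @ Q) (Comp F Gs) args out k"
    unfolding evaluates_def
  proof (intro allI impI)
    fix \<sigma> y assume "computes (Comp F Gs) (map \<sigma> args) y"
    then obtain ys where "list_all2 (\<lambda>G y. computes G (map \<sigma> args) y) Gs ys"
      and F: "computes F ys y" by (rule computes_CompE)
    from P[OF this(1)] show "ends_in (P @ Q) \<sigma> (writes k out y \<sigma>)"
    proof (rule ends_in_append, elim conjE)
      fix \<rho> assume \<rho>: "map \<rho> [k..<k + length Gs] = ys" "\<forall>j<k. \<rho> j = \<sigma> j"
      then show "ends_in Q \<rho> (writes k out y \<sigma>)"
        using evaluatesD[OF Q, of \<rho> y] F * unfolding ends_in_def writes_def by force
    qed
  qed
  then show "\<exists>P. evaluates P (Comp F Gs) args out k" ..
qed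

text \<open>
  A value of a primitive recursion is only defined if all earlier values are. This supplies the
  intermediate values that the loop of the next lemma runs through.
\<close>

lemma computes_PrimRec_below:
  "computes (PrimRec F G) ((b + a) # xs) y \<Longrightarrow> \<exists>z. computes (PrimRec F G) (a # xs) z"
  by (induction b arbitrary: y) (auto elim: computes_PrimRecSucE)

lemma compilable_PrimRec:
  assumes "compilable F" and "compilable G"
  shows "compilable (PrimRec F G)"
  unfolding compilable_def
proof (intro allI impI)
  fix args :: "nat list" and out k :: nat
  assume *: "set args \<subseteq> {..<k}" "out < k" "out \<notin> set args"
  show "\<exists>P. evaluates P (PrimRec F G) args out k"
  proof (cases args)
    case Nil
    then show ?thesis unfolding evaluates_def by (auto elim: computes.cases)
  next
    case (Cons i rest)
    have rest: "set rest \<subseteq> {..<k}" "i < k" "i \<noteq> out" using * Cons by auto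
    \<comment> \<open>\<open>c\<close> counts upwards and \<open>n\<close> counts the remaining steps; \<open>acc\<close> holds the value of the recursion at \<open>c\<close>\<close>
    define c n acc new t where regs: "c = k" "n = k + 1" "acc = k + 2" "new = k + 3" "t = k + 4"
    obtain P where P: "evaluates P F rest acc (k + 5)"
      using rest by (elim compilableD[OF assms(1), of rest "k + 5" acc, rotated -1]) (auto simp: regs)
    obtain Q where Q: "evaluates Q G (c # acc # rest) new (k + 5)"
      using rest
      by (elim compilableD[OF assms(2), of "c # acc # rest" "k + 5" new, rotated -1]) (auto simp: regs)
    define B where "B = [Dec n] @ Q @ copy new acc t @ [Inc c]"
    have loop: "ends_in [While n B] \<sigma> (\<lambda>\<tau>. \<tau> acc = y \<and> (\<forall>j<k. \<tau> j = \<sigma> j))"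
      if "map \<sigma> rest = xs" "computes (PrimRec F G) (\<sigma> c # xs) (\<sigma> acc)"
        "computes (PrimRec F G) ((\<sigma> n + \<sigma> c) # xs) y" for \<sigma> xs y
      using that
    proof (induction "\<sigma> n" arbitrary: \<sigma>)
      case 0
      then have "\<sigma> acc = y" by (auto dest: computes_unique)
      with 0 show ?case by (auto intro: ends_in_exec[OF exec_While_0])
    next
      case (Suc m)
      from Suc.prems(3) Suc.hyps(2) have "computes (PrimRec F G) ((m + Suc (\<sigma> c)) # xs) y"
        by (metis add_Suc add_Suc_right)
      from computes_PrimRec_below[OF this] obtain z where
        z: "computes (PrimRec F G) (Suc (\<sigma> c) # xs) z" by blast
      then have "computes G (\<sigma> c # \<sigma> acc # xs) z"
        using Suc.prems(2) by (auto elim!: computes_PrimRecSucE dest: computes_unique)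
      moreover let ?\<sigma>' = "\<sigma>(n := m)"
      have "map ?\<sigma>' (c # acc # rest) = \<sigma> c # \<sigma> acc # xs"
        using Suc.prems(1) rest by (auto simp: regs)
      ultimately have "ends_in Q ?\<sigma>' (writes (k + 5) new z ?\<sigma>')"
        using evaluatesD[OF Q] by metis
      then obtain \<rho> where \<rho>: "exec Q ?\<sigma>' \<rho>" "writes (k + 5) new z ?\<sigma>' \<rho>"
        unfolding ends_in_def by blast
      let ?\<rho>' = "\<rho>(acc := z, t := 0, c := Suc (\<sigma> c))"
      have keep: "?\<rho>' j = \<sigma> j" if "j < k" for j
        using \<rho>(2) that by (simp add: writes_def regs)
      have "exec (copy new acc t @ [Inc c]) \<rho> ?\<rho>'"
        using exec_append[OF exec_copy[of new acc t \<rho>] exec_Inc[of c]] \<rho>(2) by (simp add: writes_def regs)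
      then have "exec B \<sigma> ?\<rho>'"
        unfolding B_def using exec_append[OF exec_Dec[of n \<sigma>] exec_append[OF _ ]] \<rho>(1)
          Suc.hyps(2)[symmetric] by (metis diff_Suc_1)
      moreover have "ends_in [While n B] ?\<rho>' (\<lambda>\<tau>. \<tau> acc = y \<and> (\<forall>j<k. \<tau> j = ?\<rho>' j))"
      proof (rule Suc.hyps(1))
        show "m = ?\<rho>' n" using \<rho>(2) by (simp add: writes_def regs)
        have "map ?\<rho>' rest = map \<sigma> rest"
          by (intro map_cong refl keep) (use rest in auto)
        then show "map ?\<rho>' rest = xs" using Suc.prems(1) by (simp only:)
        show "computes (PrimRec F G) (?\<rho>' c # xs) (?\<rho>' acc)" using z by (simp add: regs)
        show "computes (PrimRec F G) ((?\<rho>' n + ?\<rho>' c) # xs) y"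
          using Suc.prems(3) Suc.hyps(2)[symmetric] \<rho>(2) by (simp add: writes_def regs)
      qed
      ultimately show ?case
        using keep exec_While_Suc[of \<sigma> n B ?\<rho>'] Suc.hyps(2) unfolding ends_in_def by fastforce
    qed
    have "evaluates (copy i n t @ clear c @ P @ [While n B] @ copy acc out t) (PrimRec F G) args out k"
      unfolding evaluates_def
    proof (intro allI impI)
      fix \<sigma> y assume "computes (PrimRec F G) (map \<sigma> args) y"
      then have y: "computes (PrimRec F G) (\<sigma> i # map \<sigma> rest) y" by (simp add: Cons)
      then obtain z where "computes (PrimRec F G) (0 # map \<sigma> rest) z"
        using computes_PrimRec_below[of F G "\<sigma> i" 0] by auto
      then have z: "computes (PrimRec F G) (0 # map \<sigma> rest) z" "computes F (map \<sigma> rest) z"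
        by (auto elim: computes_PrimRec0E)
      let ?\<sigma>' = "\<sigma>(n := \<sigma> i, t := 0, c := 0)"
      have rest': "map ?\<sigma>' rest = map \<sigma> rest" using rest by (auto simp: regs subset_eq)
      show "ends_in (copy i n t @ clear c @ P @ [While n B] @ copy acc out t) \<sigma> (writes k out y \<sigma>)"
      proof (rule ends_in_append[OF ends_in_copy[where \<Phi> = "\<lambda>\<tau>. \<tau> = \<sigma>(n := \<sigma> i, t := 0)"]];
          (rule ends_in_append[OF ends_in_clear[where \<Phi> = "\<lambda>\<tau>. \<tau> = ?\<sigma>'"]])?)
        fix \<rho> assume "\<rho> = ?\<sigma>'"
        moreover have "ends_in (P @ [While n B] @ copy acc out t) ?\<sigma>' (writes k out y \<sigma>)"
        proof (rule ends_in_append[OF evaluatesD[OF P, of ?\<sigma>' z]])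
          fix \<rho> assume \<rho>: "writes (k + 5) acc z ?\<sigma>' \<rho>"
          then have "map \<rho> rest = map \<sigma> rest" using rest by (auto simp: regs subset_eq writes_def)
          then have "ends_in [While n B] \<rho> (\<lambda>\<tau>. \<tau> acc = y \<and> (\<forall>j<k. \<tau> j = \<rho> j))"
            using y z \<rho> by (intro loop) (auto simp: regs writes_def)
          then show "ends_in ([While n B] @ copy acc out t) \<rho> (writes k out y \<sigma>)"
            by (rule ends_in_append, intro ends_in_copy) (use \<rho> * in \<open>auto simp: writes_def regs\<close>)
        qed (simp only: rest' z)
        ultimately show "ends_in (P @ [While n B] @ copy acc out t) \<rho> (writes k out y \<sigma>)" by simp
      qed (use rest in \<open>auto simp: regs\<close>)
    qed
    then show ?thesis ..
  qed
qed

lemma compilable_Mu: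
  assumes "compilable F"
  shows "compilable (Mu F)"
  unfolding compilable_def
proof (intro allI impI)
  fix args :: "nat list" and out k :: nat
  assume *: "set args \<subseteq> {..<k}" "out < k" "out \<notin> set args"
  \<comment> \<open>\<open>c\<close> is the candidate for the minimum, and \<open>v\<close> holds the value of \<open>F\<close> at \<open>c\<close>\<close>
  define c v t where regs: "c = k" "v = k + 1" "t = k + 2"
  obtain P where P: "evaluates P F (c # args) v (k + 3)"
    using * by (elim compilableD[OF assms(1), of "c # args" "k + 3" v, rotated -1]) (auto simp: regs)
  define B where "B = [Inc c] @ P"
  have loop: "ends_in [While v B] \<sigma> (\<lambda>\<tau>. \<tau> c = n \<and> (\<forall>j<k. \<tau> j = \<sigma> j))"
    if "map \<sigma> args = xs" "\<sigma> c \<le> n" "computes F (\<sigma> c # xs) (\<sigma> v)" "computes F (n # xs) 0"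
      "\<And>m. m < n \<Longrightarrow> \<exists>y. computes F (m # xs) (Suc y)" for \<sigma> xs n
    using that(1-3)
  proof (induction "n - \<sigma> c" arbitrary: \<sigma>)
    case 0
    then have "\<sigma> c = n" by simp
    with 0 that(4) have "\<sigma> v = 0" by (auto dest: computes_unique)
    with \<open>\<sigma> c = n\<close> show ?case by (auto intro: ends_in_exec[OF exec_While_0])
  next
    case (Suc m)
    then have "\<sigma> c < n" by simp
    with that(5) Suc.prems(3) have "\<sigma> v \<noteq> 0" by (metis computes_unique nat.distinct(1))
    from \<open>\<sigma> c < n\<close> that(4,5) obtain z where z: "computes F (Suc (\<sigma> c) # xs) z"
      by (metis Suc_lessI)
    let ?\<sigma>' = "\<sigma>(c := Suc (\<sigma> c))"
    have "map ?\<sigma>' (c # args) = Suc (\<sigma> c) # xs" using Suc.prems(1) * by (auto simp: regs subset_eq)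
    with z have "ends_in P ?\<sigma>' (writes (k + 3) v z ?\<sigma>')" using evaluatesD[OF P] by metis
    then obtain \<rho> where \<rho>: "exec P ?\<sigma>' \<rho>" "writes (k + 3) v z ?\<sigma>' \<rho>"
      unfolding ends_in_def by blast
    have "ends_in [While v B] \<rho> (\<lambda>\<tau>. \<tau> c = n \<and> (\<forall>j<k. \<tau> j = \<rho> j))"
    proof (rule Suc.hyps(1))
      show "map \<rho> args = xs" using Suc.prems(1) \<rho>(2) * by (force simp: regs writes_def subset_eq)
    qed (use Suc.hyps(2) z \<rho>(2) \<open>\<sigma> c < n\<close> in \<open>auto simp: writes_def regs\<close>)
    moreover have "\<rho> j = \<sigma> j" if "j < k" for j using \<rho>(2) that by (simp add: writes_def regs)
    moreover have "exec B \<sigma> \<rho>" unfolding B_def by (rule exec_append[OF exec_Inc \<rho>(1)])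
    ultimately show ?case
      using exec_While_Suc[of \<sigma> v B \<rho>] \<open>\<sigma> v \<noteq> 0\<close> unfolding ends_in_def by fastforce
  qed
  have "evaluates (clear c @ P @ [While v B] @ copy c out t) (Mu F) args out k"
    unfolding evaluates_def
  proof (intro allI impI)
    fix \<sigma> y assume "computes (Mu F) (map \<sigma> args) y"
    then have y: "computes F (y # map \<sigma> args) 0"
      "\<And>m. m < y \<Longrightarrow> \<exists>z. computes F (m # map \<sigma> args) (Suc z)" by (auto elim: computes_MuE)
    then obtain z where z: "computes F (0 # map \<sigma> args) z" by (cases y) auto
    let ?\<sigma>' = "\<sigma>(c := 0)"
    have "map ?\<sigma>' (c # args) = 0 # map \<sigma> args" using * by (auto simp: regs subset_eq)
    with z have P': "ends_in P ?\<sigma>' (writes (k + 3) v z ?\<sigma>')" using evaluatesD[OF P] by metis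
    have "ends_in (P @ [While v B] @ copy c out t) ?\<sigma>' (writes k out y \<sigma>)"
    proof (rule ends_in_append[OF P'])
      fix \<rho> assume \<rho>: "writes (k + 3) v z ?\<sigma>' \<rho>"
      then have "map \<rho> args = map \<sigma> args" using * by (auto simp: regs subset_eq writes_def)
      then have "ends_in [While v B] \<rho> (\<lambda>\<tau>. \<tau> c = y \<and> (\<forall>j<k. \<tau> j = \<rho> j))"
        using y z \<rho> by (intro loop) (auto simp: regs writes_def)
      then show "ends_in ([While v B] @ copy c out t) \<rho> (writes k out y \<sigma>)"
        by (rule ends_in_append, intro ends_in_copy) (use \<rho> * in \<open>auto simp: writes_def regs\<close>)
    qed
    then show "ends_in (clear c @ P @ [While v B] @ copy c out t) \<sigma> (writes k out y \<sigma>)"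
      by (intro ends_in_append[OF ends_in_clear[where \<Phi> = "\<lambda>\<tau>. \<tau> = ?\<sigma>'"]]) auto
  qed
  then show "\<exists>P. evaluates P (Mu F) args out k" ..
qed

lemma recf_compilable: "compilable F"
  by (induction F)
    (simp_all add: compilable_Zero compilable_Succ compilable_Proj compilable_Comp
      compilable_PrimRec compilable_Mu)

section \<open>Elements of 2V from finite tables\<close>

lemma suffix_conc: "suffix (length u) (u \<frown> w) = w"
  by (auto simp: fun_eq_iff)

lemma conc_same_length:
  assumes "u \<frown> x = v \<frown> y" and "length u = length v"
  shows "u = v \<and> x = y"
proof
  show "u = v"
  proof (rule nth_equalityI[OF assms(2)])
    fix i assume "i < length u"
    then show "u ! i = v ! i" using fun_cong[OF assms(1), of i] assms(2) by simp
  qed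
  then show "x = y" using assms(1) suffix_conc by metis
qed

lemma cone_iff: "w \<in> cone \<alpha> \<longleftrightarrow> (\<forall>i<length \<alpha>. w i = \<alpha> ! i)"
proof
  assume *: "\<forall>i<length \<alpha>. w i = \<alpha> ! i"
  have "w = \<alpha> \<frown> suffix (length \<alpha>) w" using * by (auto simp: fun_eq_iff conc_def)
  then show "w \<in> cone \<alpha>" unfolding cone_def by blast
qed (auto simp: cone_def)

lemma in_cone_conc: "\<alpha> \<frown> w \<in> cone \<alpha>"
  unfolding cone_def by blast

lemma in_rectangle_conc: "(a \<frown> x, b \<frown> y) \<in> rectangle (a, b)"
  by (simp add: rectangle_def in_cone_conc)

lemma rectangleE:
  assumes "p \<in> rectangle d"
  obtains x y where "p = (fst d \<frown> x, snd d \<frown> y)"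
  using assms by (auto simp: rectangle_def cone_def)

lemma open_cone: "open (cone \<alpha>)"
proof -
  have *: "cone \<alpha> = (\<Inter>i<length \<alpha>. (\<lambda>w. w i) -` {\<alpha> ! i})"
    by (rule set_eqI) (simp add: cone_iff, metis lessThan_iff)
  show ?thesis unfolding *
    by (intro open_INT ballI finite_lessThan open_vimage open_discrete continuous_on_product_coordinates)
qed

lemma open_rectangle: "open (rectangle d)"
  unfolding rectangle_def by (intro open_Times open_cone)

text \<open>
  The digits are discrete, so convergence in the product topology means that every digit
  eventually agrees with that of the limit.
\<close>

lemma tendsto_cantor_square_iff:
  fixes X :: "nat \<Rightarrow> cantor \<times> cantor"
  shows "X \<longlonglongrightarrow> q \<longleftrightarrow> (\<forall>i. (\<forall>\<^sub>F n in sequentially. fst (X n) i = fst q i) \<and>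
    (\<forall>\<^sub>F n in sequentially. snd (X n) i = snd q i))"
proof -
  have coord: "Y \<longlonglongrightarrow> w \<longleftrightarrow> (\<forall>i. \<forall>\<^sub>F n in sequentially. Y n i = w i)" for Y :: "nat \<Rightarrow> cantor" and w
  proof -
    have "Y \<longlonglongrightarrow> w \<longleftrightarrow> limitin (product_topology (\<lambda>_. euclidean) UNIV) Y w sequentially"
      by (simp add: euclidean_product_topology)
    also have "\<dots> \<longleftrightarrow> (\<forall>i. (\<lambda>n. Y n i) \<longlonglongrightarrow> w i)"
      by (simp add: limitin_componentwise)
    also have "\<dots> \<longleftrightarrow> (\<forall>i. \<forall>\<^sub>F n in sequentially. Y n i = w i)"
      by (simp add: tendsto_discrete)
    finally show ?thesis .
  qed
  have "X \<longlonglongrightarrow> q \<longleftrightarrow> (\<lambda>n. fst (X n)) \<longlonglongrightarrow> fst q \<and> (\<lambda>n. snd (X n)) \<longlonglongrightarrow> snd q"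
    using tendsto_Pair[of "\<lambda>n. fst (X n)" "fst q" sequentially "\<lambda>n. snd (X n)" "snd q"]
    by (auto intro: tendsto_fst tendsto_snd)
  then show ?thesis by (auto simp: coord)
qed

definition tiling :: "rect set \<Rightarrow> bool" where
  "tiling D \<longleftrightarrow> finite D \<and> (\<forall>p. \<exists>!d. d \<in> D \<and> p \<in> rectangle d)"

lemma dyadic_subdivision_tiling:
  assumes "tiling D"
  shows "dyadic_subdivision (rectangle ` D)"
  unfolding dyadic_subdivision_def
proof (intro conjI partition_onI)
  show "finite (rectangle ` D)" using assms by (simp add: tiling_def)
  show "\<Union> (rectangle ` D) = UNIV" using assms unfolding tiling_def by blast
  show "{} \<notin> rectangle ` D"
    using in_rectangle_conc by (metis empty_iff imageE prod.collapse)
  show "disjnt X Y" if "X \<in> rectangle ` D" "Y \<in> rectangle ` D" "X \<noteq> Y" for X Y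
    using that assms unfolding tiling_def disjnt_def by blast
qed auto

text \<open>
  The entries are pairs (domain rectangle, image rectangle). The two subdivisions in the description
  of an element of 2V, and the distinctness of their rectangles, amount to this one condition on the
  table and on the table with all pairs swapped.
\<close>

definition tabulates :: "(rect \<times> rect) set \<Rightarrow> bool" where
  "tabulates T \<longleftrightarrow> finite T \<and> (\<forall>p. \<exists>!t. t \<in> T \<and> p \<in> rectangle (fst t))"

definition replace :: "rect \<times> rect \<Rightarrow> cantor \<times> cantor \<Rightarrow> cantor \<times> cantor" where
  "replace t p = (fst (snd t) \<frown> suffix (length (fst (fst t))) (fst p),
    snd (snd t) \<frown> suffix (length (snd (fst t))) (snd p))"

lemma replace_conc:
  "replace (d, r) (fst d \<frown> x, snd d \<frown> y) = (fst r \<frown> x, snd r \<frown> y)"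
  by (simp add: replace_def suffix_conc)

lemma replace_rectangle:
  assumes "p \<in> rectangle (fst t)"
  shows "replace t p \<in> rectangle (snd t)" and "replace (prod.swap t) (replace t p) = p"
proof -
  obtain d r where t: "t = (d, r)" by (cases t)
  with assms obtain x y where p: "p = (fst d \<frown> x, snd d \<frown> y)" by (auto elim: rectangleE)
  show "replace t p \<in> rectangle (snd t)"
    using in_rectangle_conc[of "fst r" x "snd r" y] by (simp add: t p replace_conc)
  show "replace (prod.swap t) (replace t p) = p" by (simp add: t p replace_conc)
qed

lemma continuous_replace: "continuous_on UNIV (replace t)"
proof -
  have *: "continuous_on UNIV (\<lambda>w :: cantor. u \<frown> suffix k w)" for u k
  proof (rule continuous_on_coordinatewise_then_product)
    fix i
    show "continuous_on UNIV (\<lambda>w :: cantor. (u \<frown> suffix k w) i)"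
      by (cases "i < length u") (simp_all add: continuous_on_product_coordinates)
  qed
  show ?thesis unfolding replace_def
    by (intro continuous_on_Pair continuous_on_compose2[OF *] continuous_on_fst continuous_on_snd
        continuous_on_id) auto
qed

definition table_map :: "(rect \<times> rect) set \<Rightarrow> cantor \<times> cantor \<Rightarrow> cantor \<times> cantor" where
  "table_map T p = replace (THE t. t \<in> T \<and> p \<in> rectangle (fst t)) p"

lemma table_map_eq:
  assumes "tabulates T" "t \<in> T" "p \<in> rectangle (fst t)"
  shows "table_map T p = replace t p"
proof -
  have "(THE t. t \<in> T \<and> p \<in> rectangle (fst t)) = t"
    using assms unfolding tabulates_def by (blast intro: the1_equality)
  then show ?thesis by (simp add: table_map_def)
qed

lemma continuous_table_map:
  assumes "tabulates T"
  shows "continuous_on UNIV (table_map T)"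
proof -
  have "continuous_on (\<Union>t\<in>T. rectangle (fst t)) (table_map T)"
  proof (rule continuous_on_open_UN)
    fix t assume "t \<in> T"
    have "continuous_on (rectangle (fst t)) (replace t)"
      by (rule continuous_on_subset[OF continuous_replace]) simp
    then show "continuous_on (rectangle (fst t)) (table_map T)"
      using table_map_eq[OF assms \<open>t \<in> T\<close>] by (simp cong: continuous_on_cong)
  qed (rule open_rectangle)
  moreover have "(\<Union>t\<in>T. rectangle (fst t)) = UNIV" using assms unfolding tabulates_def by blast
  ultimately show ?thesis by simp
qed

lemma table_map_swap:
  assumes "tabulates T" "tabulates (prod.swap ` T)"
  shows "table_map (prod.swap ` T) (table_map T p) = p"
proof -
  obtain t where t: "t \<in> T" "p \<in> rectangle (fst t)" using assms(1) unfolding tabulates_def by blast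
  then have "table_map T p = replace t p" by (rule table_map_eq[OF assms(1)])
  moreover have "table_map (prod.swap ` T) (replace t p) = replace (prod.swap t) (replace t p)"
    using t replace_rectangle(1)[OF t(2)] by (intro table_map_eq[OF assms(2)]) auto
  ultimately show ?thesis using replace_rectangle(2)[OF t(2)] by simp
qed

lemma tabulates_fst:
  assumes "tabulates T"
  shows "tiling (fst ` T)" and "inj_on fst T"
proof -
  show "tiling (fst ` T)" using assms unfolding tabulates_def tiling_def by blast
  show "inj_on fst T"
  proof (rule inj_onI)
    fix t t' assume *: "t \<in> T" "t' \<in> T" "fst t = fst t'"
    obtain p where "p \<in> rectangle (fst t)" using in_rectangle_conc by (metis prod.collapse)
    with * assms show "t = t'" unfolding tabulates_def by metis
  qed
qed

text \<open>
  A table that is valid in both directions is an element of 2V: on each domain rectangle,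
  which is open, the map is a continuous prefix replacement, and the swapped table is its inverse.
\<close>

lemma table_map_in_2V:
  assumes "tabulates T" "tabulates (prod.swap ` T)"
  obtains L where "set L = T" "describes_element L (table_map T)" "table_map T \<in> brin_thompson_2V"
proof -
  have snd_swap: "fst ` prod.swap ` T = snd ` T" by (simp add: image_image)
  have "finite T" using assms(1) by (simp add: tabulates_def)
  then obtain L where L: "set L = T" "distinct L" using finite_distinct_list by blast
  have "inj_on (fst \<circ> prod.swap) T"
    by (rule comp_inj_on[OF _ tabulates_fst(2)[OF assms(2)]]) simp
  then have "inj_on snd T" by (simp add: inj_on_def)
  have repl: "prefix_replacement (table_map T) (fst t) (snd t)" if "t \<in> T" for t
    unfolding prefix_replacement_def
  proof (intro allI)
    fix x y
    have "(fst (fst t) \<frown> x, snd (fst t) \<frown> y) \<in> rectangle (fst t)"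
      using in_rectangle_conc by (metis prod.collapse)
    then show "table_map T (fst (fst t) \<frown> x, snd (fst t) \<frown> y) = (fst (snd t) \<frown> x, snd (snd t) \<frown> y)"
      using table_map_eq[OF assms(1) that] replace_conc by (metis prod.collapse)
  qed
  have describes: "describes_element L (table_map T)"
    unfolding describes_element_def L(1)
    using L tabulates_fst[OF assms(1)] tabulates_fst(1)[OF assms(2)] \<open>inj_on snd T\<close> repl
    by (auto simp: distinct_map snd_swap dyadic_subdivision_tiling)
  have "homeomorphism UNIV UNIV (table_map T) (table_map (prod.swap ` T))"
  proof (rule homeomorphismI)
    have "prod.swap ` prod.swap ` T = T" by (simp add: image_image)
    then show "table_map T (table_map (prod.swap ` T) p) = p" for p
      using table_map_swap[OF assms(2)] assms(1) by simp
  qed (use continuous_table_map[OF assms(1)] continuous_table_map[OF assms(2)]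
      table_map_swap[OF assms] in auto)
  moreover have "\<forall>X\<in>rectangle ` fst ` T. \<exists>d r. X = rectangle d \<and> prefix_replacement (table_map T) d r"
    using repl by blast
  ultimately have "table_map T \<in> brin_thompson_2V"
    unfolding brin_thompson_2V_def
    using dyadic_subdivision_tiling[OF tabulates_fst(1)[OF assms(1)]] by blast
  with L(1) describes show thesis by (rule that)
qed

text \<open>
  Indexed by \<open>S\<close>, so that two entries with the same rectangle count as overlapping.
\<close>

definition non_overlapping :: "('a \<Rightarrow> rect) \<Rightarrow> 'a set \<Rightarrow> bool" where
  "non_overlapping h S \<longleftrightarrow>
    (\<forall>s\<in>S. \<forall>t\<in>S. \<forall>p. p \<in> rectangle (h s) \<longrightarrow> p \<in> rectangle (h t) \<longrightarrow> s = t)"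

definition complements :: "rect set \<Rightarrow> rect set \<Rightarrow> bool" where
  "complements E D \<longleftrightarrow> finite E \<and> non_overlapping (\<lambda>e. e) E \<and>
    (\<forall>p. (\<exists>e\<in>E. p \<in> rectangle e) \<longleftrightarrow> \<not> (\<exists>d\<in>D. p \<in> rectangle d))"

lemma non_overlappingD:
  "\<lbrakk>non_overlapping h S; s \<in> S; t \<in> S; p \<in> rectangle (h s); p \<in> rectangle (h t)\<rbrakk> \<Longrightarrow> s = t"
  unfolding non_overlapping_def by blast

lemma complementsD:
  assumes "complements E (h ` R)"
  shows "(\<exists>e\<in>E. p \<in> rectangle e) \<longleftrightarrow> \<not> (\<exists>s\<in>R. p \<in> rectangle (h s))"
    and "\<lbrakk>e \<in> E; e' \<in> E; p \<in> rectangle e; p \<in> rectangle e'\<rbrakk> \<Longrightarrow> e = e'"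
proof -
  show "(\<exists>e\<in>E. p \<in> rectangle e) \<longleftrightarrow> \<not> (\<exists>s\<in>R. p \<in> rectangle (h s))"
    using assms by (cases p) (simp add: complements_def)
  show "\<lbrakk>e \<in> E; e' \<in> E; p \<in> rectangle e; p \<in> rectangle e'\<rbrakk> \<Longrightarrow> e = e'"
    using assms non_overlappingD[of "\<lambda>e. e" E e e' p] unfolding complements_def by blast
qed

lemma non_overlapping_swap:
  "non_overlapping snd R \<Longrightarrow> non_overlapping fst (prod.swap ` R)"
  "non_overlapping fst R \<Longrightarrow> non_overlapping snd (prod.swap ` R)"
  unfolding non_overlapping_def by (simp_all, metis+)

text \<open>
  In the subdivision into squares with side words of a length \<open>n\<close> that is at least as long as all
  words in \<open>D\<close>, each square is contained in or disjoint from each rectangle of \<open>D\<close>. The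
  squares of the second kind tile the complement.
\<close>

lemma complement_of_rectangles:
  assumes "finite D"
  shows "\<exists>E. complements E D"
proof -
  define n where "n = Max (insert 0 ((\<lambda>d. length (fst d)) ` D \<union> (\<lambda>d. length (snd d)) ` D))"
  have n: "length (fst d) \<le> n" "length (snd d) \<le> n" if "d \<in> D" for d
    unfolding n_def using assms that by (auto intro!: Max_ge)
  define words :: "bool list set" where "words = {\<alpha>. length \<alpha> = n}"
  define E where "E = {e \<in> words \<times> words. \<forall>d\<in>D. rectangle e \<inter> rectangle d = {}}"
  have "finite words" unfolding words_def using finite_lists_length_eq[of "UNIV :: bool set" n] by simp
  then have "finite E" unfolding E_def by simp
  moreover have "e = e'" if "e \<in> E" "e' \<in> E" "p \<in> rectangle e" "p \<in> rectangle e'" for e e' p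
  proof -
    have "length (fst e) = length (fst e')" "length (snd e) = length (snd e')"
      using that(1,2) by (auto simp: E_def words_def)
    then show ?thesis using that(3,4) by (auto elim!: rectangleE dest!: conc_same_length simp: prod_eq_iff)
  qed
  moreover have "(\<exists>e\<in>E. p \<in> rectangle e) \<longleftrightarrow> \<not> (\<exists>d\<in>D. p \<in> rectangle d)" for p
  proof
    assume p_out: "\<not> (\<exists>d\<in>D. p \<in> rectangle d)"
    define e where "e = (map (fst p) [0..<n], map (snd p) [0..<n])"
    have p: "p \<in> rectangle e" by (cases p) (simp add: e_def rectangle_def cone_iff)
    have "rectangle e \<inter> rectangle d = {}" if "d \<in> D" for d
    proof (rule ccontr)
      assume "rectangle e \<inter> rectangle d \<noteq> {}"
      then have "p \<in> rectangle d"
        using n[OF that] by (cases p) (force simp: e_def rectangle_def cone_iff mem_Times_iff)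
      with p_out that show False by blast
    qed
    then have "e \<in> E" by (simp add: E_def) (simp add: words_def e_def)
    with p show "\<exists>e\<in>E. p \<in> rectangle e" ..
  qed (auto simp: E_def)
  ultimately have "complements E D" unfolding complements_def non_overlapping_def by blast
  then show ?thesis ..
qed

text \<open>
  The first digit of the first coordinate splits the square into two copies of itself.
\<close>

definition in_copy :: "bool \<Rightarrow> rect \<Rightarrow> rect" where
  "in_copy b d = (b # fst d, snd d)"

lemma in_copy_iff:
  "p \<in> rectangle (in_copy b d) \<longleftrightarrow> fst p 0 = b \<and> (suffix 1 (fst p), snd p) \<in> rectangle d"
  by (cases p) (auto simp: in_copy_def rectangle_def cone_iff nth_Cons split: nat.splits)

text \<open>
  The table \<open>R\<close> acts forwards in copy \<open>False\<close> and backwards in copy \<open>True\<close>.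
  The rectangles in \<open>D\<close>, outside the domain of \<open>R\<close>, pass from the first copy to the second, and the
  rectangles in \<open>E\<close>, outside its image, pass back. Each tile of a complement is thus
  paired with its own translate in the other copy, even if the complements of domain and image have
  different numbers of tiles.
\<close>

definition doubled :: "(rect \<times> rect) set \<Rightarrow> rect set \<Rightarrow> rect set \<Rightarrow> (rect \<times> rect) set" where
  "doubled R D E =
    (\<lambda>t. (in_copy False (fst t), in_copy False (snd t))) ` R \<union>
    (\<lambda>e. (in_copy False e, in_copy True e)) ` D \<union>
    (\<lambda>t. (in_copy True (snd t), in_copy True (fst t))) ` R \<union>
    (\<lambda>e. (in_copy True e, in_copy False e)) ` E"

lemma swap_doubled: "prod.swap ` doubled R D E = doubled (prod.swap ` R) E D"
  unfolding doubled_def by (auto simp: image_Un image_image)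

text \<open>
  In each copy, the entries of a doubled table come from two families, and a point is
  covered by one entry of one of them: the rules, or the tiles of the complement.
\<close>

lemma ex1_cover:
  assumes "(\<exists>e\<in>D. Q e) \<longleftrightarrow> \<not> (\<exists>s\<in>R. P s)"
    and "\<And>s s'. s \<in> R \<Longrightarrow> s' \<in> R \<Longrightarrow> P s \<Longrightarrow> P s' \<Longrightarrow> s = s'"
    and "\<And>e e'. e \<in> D \<Longrightarrow> e' \<in> D \<Longrightarrow> Q e \<Longrightarrow> Q e' \<Longrightarrow> e = e'"
  shows "\<exists>!t. (\<exists>s\<in>R. t = A s \<and> P s) \<or> (\<exists>e\<in>D. t = B e \<and> Q e)"
  using assms by metis

lemma tabulates_doubled:
  assumes "finite R" "non_overlapping fst R" "non_overlapping snd R"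
    and D: "complements D (fst ` R)" and E: "complements E (snd ` R)"
  shows "tabulates (doubled R D E)"
  unfolding tabulates_def
proof (intro conjI allI)
  show "finite (doubled R D E)"
    using assms unfolding doubled_def complements_def by simp
  fix p :: "cantor \<times> cantor"
  define p' where "p' = (suffix 1 (fst p), snd p)"
  have pull: "(\<exists>s\<in>S. t = A s) \<and> p \<in> rectangle (fst t) \<longleftrightarrow> (\<exists>s\<in>S. t = A s \<and> p \<in> rectangle (fst (A s)))"
    for t and S :: "'c set" and A by blast
  show "\<exists>!t. t \<in> doubled R D E \<and> p \<in> rectangle (fst t)"
  proof (cases "fst p 0")
    case True
    have mem: "p \<in> rectangle (in_copy b d) \<longleftrightarrow> b \<and> p' \<in> rectangle d" for b d
      using True by (simp add: in_copy_iff p'_def)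
    have *: "t \<in> doubled R D E \<and> p \<in> rectangle (fst t) \<longleftrightarrow>
      (\<exists>s\<in>R. t = (in_copy True (snd s), in_copy True (fst s)) \<and> p' \<in> rectangle (snd s)) \<or>
      (\<exists>e\<in>E. t = (in_copy True e, in_copy False e) \<and> p' \<in> rectangle e)" for t
      unfolding doubled_def Un_iff image_iff conj_disj_distribR pull by (simp add: mem)
    show ?thesis unfolding *
      by (rule ex1_cover[OF complementsD(1)[OF E] non_overlappingD[OF assms(3)] complementsD(2)[OF E]])
  next
    case False
    have mem: "p \<in> rectangle (in_copy b d) \<longleftrightarrow> \<not> b \<and> p' \<in> rectangle d" for b d
      using False by (auto simp: in_copy_iff p'_def)
    have *: "t \<in> doubled R D E \<and> p \<in> rectangle (fst t) \<longleftrightarrow>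
      (\<exists>s\<in>R. t = (in_copy False (fst s), in_copy False (snd s)) \<and> p' \<in> rectangle (fst s)) \<or>
      (\<exists>e\<in>D. t = (in_copy False e, in_copy True e) \<and> p' \<in> rectangle e)" for t
      unfolding doubled_def Un_iff image_iff conj_disj_distribR pull by (simp add: mem)
    show ?thesis unfolding *
      by (rule ex1_cover[OF complementsD(1)[OF D] non_overlappingD[OF assms(2)] complementsD(2)[OF D]])
  qed
qed

lemma injective_rules_in_2V:
  assumes "finite R" "non_overlapping fst R" "non_overlapping snd R"
  obtains L f where "describes_element L f" "f \<in> brin_thompson_2V"
    "\<And>d r. (d, r) \<in> R \<Longrightarrow> prefix_replacement f (in_copy False d) (in_copy False r)"
proof -
  obtain D where D: "complements D (fst ` R)"
    using complement_of_rectangles assms(1) by blast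
  obtain E where E: "complements E (snd ` R)"
    using complement_of_rectangles assms(1) by blast
  have T: "tabulates (doubled R D E)"
    using assms D E by (rule tabulates_doubled)
  have "tabulates (doubled (prod.swap ` R) E D)"
    using assms D E by (intro tabulates_doubled non_overlapping_swap) (simp_all add: image_image)
  then have T': "tabulates (prod.swap ` doubled R D E)" by (simp add: swap_doubled)
  obtain L where L: "set L = doubled R D E" "describes_element L (table_map (doubled R D E))"
    "table_map (doubled R D E) \<in> brin_thompson_2V"
    using table_map_in_2V[OF T T'] .
  from L(2,3) show thesis
  proof (rule that)
    fix d r assume "(d, r) \<in> R"
    then have "(in_copy False d, in_copy False r) \<in> set L" unfolding L(1) doubled_def by force
    with L(2) show "prefix_replacement (table_map (doubled R D E)) (in_copy False d) (in_copy False r)"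
      unfolding describes_element_def by blast
  qed
qed

section \<open>A reversible machine for a program\<close>

instance cmd :: countable by countable_datatype

text \<open>
  \<open>At K\<close>: at the first cell, about to execute \<open>K\<close>. \<open>Out K j\<close>: walking out in cell
  \<open>j\<close>. \<open>Back K b j\<close>: walking back in cell \<open>j\<close>, after finding that the register
  was nonzero (\<open>b\<close>) or zero. \<open>Sink b\<close>: halted, with the value of register 0 nonzero or zero.
\<close>

datatype state = Start | At "cmd list" | Out "cmd list" nat | Back "cmd list" bool nat | Sink bool

instance state :: countable by countable_datatype

text \<open>
  Words of this form are a prefix code: none is a proper prefix of another, so the state can be
  read off from the left stack, and records of past states on that stack can be told apart.
\<close>

definition state_word :: "state \<Rightarrow> bool list" where
  "state_word s = replicate (to_nat s) True @ [False]"

text \<open>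
  Equivalent to the two cones having a common point, and hence the form in which overlaps of rules
  are excluded.
\<close>

definition compatible :: "bool list \<Rightarrow> bool list \<Rightarrow> bool" where
  "compatible u v \<longleftrightarrow> (\<exists>x y. u \<frown> x = v \<frown> y)"

lemma compatible_Nil: "compatible [] v" "compatible u []"
  unfolding compatible_def by auto

lemma compatible_Cons: "compatible (a # u) (b # v) \<longleftrightarrow> a = b \<and> compatible u v"
  unfolding compatible_def by simp

declare build_cons [simp del] build_append [simp del]

lemma compatible_code: "compatible (state_word s @ u) (state_word t @ v) \<longleftrightarrow> s = t \<and> compatible u v"
proof -
  have "compatible (replicate m True @ False # u) (replicate n True @ False # v)
    \<longleftrightarrow> m = n \<and> compatible u v" for m n
  proof (induction m arbitrary: n)
    case 0
    show ?case by (cases n) (simp_all add: compatible_Cons)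
  next
    case (Suc m)
    then show ?case by (cases n) (simp_all add: compatible_Cons)
  qed
  then show ?thesis by (simp add: state_word_def)
qed

lemma compatible_code': "compatible (state_word s) (state_word t) \<longleftrightarrow> s = t"
  using compatible_code[of s "[]" t "[]"] by (simp add: compatible_Nil)

text \<open>
  A state together with the topmost bits of the left and the right stack.
\<close>

type_synonym pattern = "state \<times> bool list \<times> bool list"

definition place :: "pattern \<Rightarrow> rect" where
  "place c = (state_word (fst c) @ fst (snd c), snd (snd c))"

lemma overlapping_places:
  assumes "p \<in> rectangle (place (s, a, b))" "p \<in> rectangle (place (s', a', b'))"
  shows "s = s' \<and> compatible a a' \<and> compatible b b'"
proof -
  have "compatible (state_word s @ a) (state_word s' @ a')" "compatible b b'"
    using assms by (auto simp: rectangle_def cone_def compatible_def place_def)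
  then show ?thesis by (simp add: compatible_code)
qed

text \<open>
  After the walk through a block of ones, the top of the left stack is a one of this block if the
  register is nonzero, and the zero before the block otherwise. The topmost bit \<open>b\<close> is replaced by
  these bits, which lengthens, shortens or keeps the block.
\<close>

fun written :: "cmd \<Rightarrow> bool \<Rightarrow> bool list" where
  "written (Inc r) b = [True, b]"
| "written (Dec r) b = (if b then [] else [False])"
| "written (While r B) b = [b]"

text \<open>
  The entry rule pushes a zero that marks the bottom of the walk. Walking out, a one is
  shifted within a cell and a zero is shifted when passing to the next cell; so the bit just
  written to the left stack tells from which state \<open>Out K j\<close> was entered. Walking
  back, the bit just written to the right stack does the same for \<open>Back K b j\<close>. The last rule replaces
  the marker by the word of the state that it leaves; this record makes the images of all rules that enter the same state \<open>At K\<close> disjoint.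
\<close>

definition command_rules :: "cmd list \<Rightarrow> (pattern \<times> pattern) set" where
  "command_rules K =
    {((At K, [], []), (Out K 0, [False], []))} \<union>
    (\<lambda>j. ((Out K j, [], [True]), (Out K j, [True], []))) ` {..reg (hd K)} \<union>
    (\<lambda>j. ((Out K j, [], [False]), (Out K (Suc j), [False], []))) ` {..<reg (hd K)} \<union>
    (\<lambda>b. ((Out K (reg (hd K)), [b], [False]),
           (Back K b (reg (hd K)), written (hd K) b, [False]))) ` UNIV \<union>
    (\<Union>b. (\<lambda>j. ((Back K b j, [True], []), (Back K b j, [], [True]))) ` {..reg (hd K)}) \<union>
    (\<Union>b. (\<lambda>j. ((Back K b (Suc j), [False], []), (Back K b j, [], [False]))) ` {..<reg (hd K)}) \<union>
    (\<lambda>b. ((Back K b 0, [False], []), (At (continuation K b), state_word (Back K b 0), []))) ` UNIV"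

text \<open>
  In a sink, zeros are pushed on both stacks forever. The digit one pushed on entry
  separates the entering points from those that have been there before.
\<close>

definition machine :: "cmd list set \<Rightarrow> cmd list \<Rightarrow> (pattern \<times> pattern) set" where
  "machine Q P =
    {((Start, [], []), (At P, state_word Start, []))} \<union>
    (\<Union>K\<in>Q - {[]}. command_rules K) \<union>
    (\<lambda>b. ((At [], [], [b]), (Sink b, [True], [b]))) ` UNIV \<union>
    (\<lambda>b. ((Sink b, [], []), (Sink b, [False], [False]))) ` UNIV"

definition clash :: "pattern \<Rightarrow> pattern \<Rightarrow> bool" where
  "clash c d \<longleftrightarrow> fst c = fst d \<and> compatible (fst (snd c)) (fst (snd d)) \<and> compatible (snd (snd c)) (snd (snd d))"

lemma finite_machine: "finite Q \<Longrightarrow> finite (machine Q P)"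
  unfolding machine_def command_rules_def by auto

lemma machine_deterministic:
  assumes "t \<in> machine Q P" "t' \<in> machine Q P" "clash (fst t) (fst t')"
  shows "t = t'"
  using assms unfolding machine_def command_rules_def
  by (elim UnE UN_E imageE singletonE)
    (simp_all only: clash_def fst_conv snd_conv compatible_Cons compatible_Nil
      state.distinct state.inject, simp_all)

text \<open>
  Rules with the same target state differ in a bit or in a record that they have just pushed.
\<close>

lemma machine_reversible:
  assumes "t \<in> machine Q P" "t' \<in> machine Q P" "clash (snd t) (snd t')"
  shows "t = t'"
  using assms unfolding machine_def command_rules_def
  by (elim UnE UN_E imageE singletonE)
    (simp_all only: clash_def fst_conv snd_conv compatible_Cons compatible_Nil compatible_code'
      state.distinct state.inject, simp_all)

lemma machine_realised_in_2V:
  assumes "finite Q"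
  obtains L f where "describes_element L f" "f \<in> brin_thompson_2V"
    "\<And>c d. (c, d) \<in> machine Q P \<Longrightarrow>
      prefix_replacement f (in_copy False (place c)) (in_copy False (place d))"
proof -
  define R where "R = (\<lambda>t. (place (fst t), place (snd t))) ` machine Q P"
  have clash: "clash c d" if "p \<in> rectangle (place c)" "p \<in> rectangle (place d)" for c d p
    using that overlapping_places by (cases c; cases d) (auto simp: clash_def)
  have "finite R" unfolding R_def using finite_machine[OF assms] by simp
  moreover have "non_overlapping fst R" "non_overlapping snd R"
    unfolding non_overlapping_def R_def
    using machine_deterministic[of _ Q P] machine_reversible[of _ Q P] clash
    by (simp, metis)+
  ultimately obtain L f where Lf: "describes_element L f" "f \<in> brin_thompson_2V"
    "\<And>d r. (d, r) \<in> R \<Longrightarrow> prefix_replacement f (in_copy False d) (in_copy False r)"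
    using injective_rules_in_2V by metis
  then show thesis using that unfolding R_def by (metis (no_types, lifting) fst_conv image_eqI snd_conv)
qed

definition blocks :: "nat list \<Rightarrow> bool list" where
  "blocks xs = concat (map (\<lambda>n. replicate n True @ [False]) xs)"

lemma blocks_Nil [simp]: "blocks [] = []"
  and blocks_Cons [simp]: "blocks (n # xs) = replicate n True @ False # blocks xs"
  and blocks_append [simp]: "blocks (xs @ ys) = blocks xs @ blocks ys"
  by (simp_all add: blocks_def)

text \<open>
  Only the copy \<open>False\<close> of the square is used, where the rules act forwards.
\<close>

definition config :: "state \<Rightarrow> cantor \<Rightarrow> cantor \<Rightarrow> cantor \<times> cantor" where
  "config s l r = ((False # state_word s) \<frown> l, r)"

text \<open>
  Only the behaviour of \<open>f\<close> under the rules counts for the simulation. As \<open>Q\<close> contains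
  \<open>P\<close> and is closed, a run of \<open>P\<close> never leaves \<open>Q\<close>.
\<close>

locale simulation =
  fixes f :: "cantor \<times> cantor \<Rightarrow> cantor \<times> cantor" and Q :: "cmd list set" and P :: "cmd list" and N :: nat
  assumes rules: "(c, d) \<in> machine Q P \<Longrightarrow>
      prefix_replacement f (in_copy False (place c)) (in_copy False (place d))"
    and closed: "K \<in> Q \<Longrightarrow> K \<noteq> [] \<Longrightarrow> continuation K b \<in> Q"
    and start_in: "P \<in> Q"
    and bound: "K \<in> Q \<Longrightarrow> K \<noteq> [] \<Longrightarrow> reg (hd K) < N"
    and N_pos: "0 < N"
begin

definition reaches :: "cantor \<times> cantor \<Rightarrow> cantor \<times> cantor \<Rightarrow> bool" where
  "reaches p p' \<longleftrightarrow> (\<exists>n. (f ^^ n) p = p')"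

lemma reaches_refl: "reaches p p"
  unfolding reaches_def by (intro exI[of _ 0]) simp

lemma reaches_trans [trans]: "reaches p p' \<Longrightarrow> reaches p' p'' \<Longrightarrow> reaches p p''"
  unfolding reaches_def by (metis comp_apply funpow_add)

lemma step:
  assumes "((s, a, b), (t, c, d)) \<in> machine Q P"
  shows "f (config s (a \<frown> l) (b \<frown> r)) = config t (c \<frown> l) (d \<frown> r)"
  using rules[OF assms] by (simp add: prefix_replacement_def in_copy_def place_def config_def)

lemma reaches_step:
  assumes "((s, a, b), (t, c, d)) \<in> machine Q P"
  shows "reaches (config s (a \<frown> l) (b \<frown> r)) (config t (c \<frown> l) (d \<frown> r))"
  unfolding reaches_def using step[OF assms] by (intro exI[of _ 1]) simp

context
  fixes K :: "cmd list"
  assumes K: "K \<in> Q" "K \<noteq> []"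
begin

lemma rule_in: "t \<in> command_rules K \<Longrightarrow> t \<in> machine Q P"
  using K unfolding machine_def by blast

lemma out_ones:
  assumes "j \<le> reg (hd K)"
  shows "reaches (config (Out K j) l (replicate n True \<frown> w)) (config (Out K j) (replicate n True \<frown> l) w)"
proof (induction n arbitrary: l)
  case (Suc n)
  have "((Out K j, [], [True]), (Out K j, [True], [])) \<in> machine Q P"
    using assms by (intro rule_in) (force simp: command_rules_def)
  from reaches_step[OF this, of l "replicate n True \<frown> w"]
  have "reaches (config (Out K j) l (replicate (Suc n) True \<frown> w)) (config (Out K j) ([True] \<frown> l) (replicate n True \<frown> w))"
    by simp
  also note Suc.IH[of "[True] \<frown> l"]
  finally show ?case by (simp add: replicate_append_same)
qed (simp add: reaches_refl)

text \<open>
  The walk reverses what it passes, since bits are popped from one stack and pushed on the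
  other.
\<close>

lemma out_cells:
  assumes "j + length xs \<le> reg (hd K)"
  shows "reaches (config (Out K j) l (blocks xs \<frown> w)) (config (Out K (j + length xs)) (rev (blocks xs) \<frown> l) w)"
  using assms
proof (induction xs arbitrary: j l)
  case (Cons x xs)
  have next_cell: "((Out K j, [], [False]), (Out K (Suc j), [False], [])) \<in> machine Q P"
    using Cons.prems by (intro rule_in) (force simp: command_rules_def)
  have "reaches (config (Out K j) l (blocks (x # xs) \<frown> w))
      (config (Out K j) (replicate x True \<frown> l) ([False] \<frown> blocks xs \<frown> w))"
    using out_ones[of j l x "(False # blocks xs) \<frown> w"] Cons.prems by simp
  also have "reaches (config (Out K j) (replicate x True \<frown> l) ([False] \<frown> blocks xs \<frown> w))
      (config (Out K (Suc j)) ((False # replicate x True) \<frown> l) (blocks xs \<frown> w))"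
    using reaches_step[OF next_cell, of "replicate x True \<frown> l" "blocks xs \<frown> w"] by simp
  also note Cons.IH[of "Suc j" "(False # replicate x True) \<frown> l"]
  finally show ?case using Cons.prems by simp
qed (simp add: reaches_refl)

lemma back_ones:
  assumes "j \<le> reg (hd K)"
  shows "reaches (config (Back K b j) (replicate n True \<frown> l) w) (config (Back K b j) l (replicate n True \<frown> w))"
proof (induction n arbitrary: w)
  case (Suc n)
  have "((Back K b j, [True], []), (Back K b j, [], [True])) \<in> machine Q P"
    using assms by (intro rule_in) (force simp: command_rules_def)
  from reaches_step[OF this, of "replicate n True \<frown> l" w]
  have "reaches (config (Back K b j) (replicate (Suc n) True \<frown> l) w)
      (config (Back K b j) (replicate n True \<frown> l) ([True] \<frown> w))" by simp
  also note Suc.IH[of "[True] \<frown> w"]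
  finally show ?case by (simp add: replicate_append_same)
qed (simp add: reaches_refl)

lemma back_cells:
  assumes "length xs \<le> reg (hd K)"
  shows "reaches (config (Back K b (length xs)) (rev (False # blocks xs) \<frown> l) w)
    (config (Back K b 0) ([False] \<frown> l) (blocks xs \<frown> w))"
  using assms
proof (induction xs arbitrary: w rule: rev_induct)
  case (snoc x xs)
  let ?l = "rev (False # blocks xs)"
  have "((Back K b (Suc (length xs)), [False], []), (Back K b (length xs), [], [False])) \<in> machine Q P"
    using snoc.prems by (intro rule_in) (force simp: command_rules_def)
  from reaches_step[OF this, of "(replicate x True @ ?l) \<frown> l" w]
  have "reaches (config (Back K b (length (xs @ [x]))) (rev (False # blocks (xs @ [x])) \<frown> l) w)
      (config (Back K b (length xs)) (replicate x True \<frown> ?l \<frown> l) ([False] \<frown> w))" by simp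
  also have "reaches (config (Back K b (length xs)) (replicate x True \<frown> ?l \<frown> l) ([False] \<frown> w))
      (config (Back K b (length xs)) (?l \<frown> l) ((replicate x True @ [False]) \<frown> w))"
    using back_ones[of "length xs" b x "?l \<frown> l" "[False] \<frown> w"] snoc.prems by simp
  also note snoc.IH[of "(replicate x True @ [False]) \<frown> w"]
  finally show ?case using snoc.prems by simp
qed (simp add: reaches_refl)

text \<open>
  The zero that closes the block is seen on the right stack. The word \<open>z\<close> stands for the
  preceding cells; the zero in front of it is the end of the previous block or the marker.
\<close>

lemma act_on_cell:
  "reaches (config (Out K (reg (hd K))) ((replicate n True @ False # z) \<frown> l) ([False] \<frown> w))
    (config (Back K (n \<noteq> 0) (reg (hd K))) ((replicate (update (hd K) n) True @ False # z) \<frown> l) ([False] \<frown> w))"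
proof -
  have rule: "((Out K (reg (hd K)), [b], [False]), (Back K b (reg (hd K)), written (hd K) b, [False]))
      \<in> machine Q P" for b
    by (intro rule_in) (force simp: command_rules_def)
  show ?thesis
  proof (cases n)
    case 0
    then show ?thesis using reaches_step[OF rule[of False], of "z \<frown> l" w] by (cases "hd K") simp_all
  next
    case (Suc m)
    then show ?thesis
      using reaches_step[OF rule[of True], of "(replicate m True @ False # z) \<frown> l" w]
      by (cases "hd K") simp_all
  qed
qed

text \<open>
  One command, from the first cell to its register and back. The
  left stack \<open>h\<close> is arbitrary, which is why the growing record of the past does no harm.
\<close>

lemma command_on_cells:
  assumes "length xs = reg (hd K)"
  shows "\<exists>h'. reaches (config (At K) h (blocks (xs @ n # ys) \<frown> w))
    (config (At (continuation K (n \<noteq> 0))) h' (blocks (xs @ update (hd K) n # ys) \<frown> w))"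
proof
  let ?r = "reg (hd K)" and ?b = "n \<noteq> 0" and ?n' = "update (hd K) n"
  obtain z where z: "rev (False # blocks xs) = False # z"
    by (cases xs rule: rev_cases) auto
  have return: "((Back K ?b 0, [False], []), (At (continuation K ?b), state_word (Back K ?b 0), [])) \<in> machine Q P"
    by (intro rule_in) (force simp: command_rules_def)
  have "((At K, [], []), (Out K 0, [False], [])) \<in> machine Q P"
    by (intro rule_in) (force simp: command_rules_def)
  from reaches_step[OF this, of h "blocks (xs @ n # ys) \<frown> w"]
  have "reaches (config (At K) h (blocks (xs @ n # ys) \<frown> w))
      (config (Out K 0) ([False] \<frown> h) (blocks xs \<frown> blocks (n # ys) \<frown> w))" by simp
  also have "reaches (config (Out K 0) ([False] \<frown> h) (blocks xs \<frown> blocks (n # ys) \<frown> w))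
      (config (Out K ?r) (rev (blocks xs) \<frown> [False] \<frown> h) (blocks (n # ys) \<frown> w))"
    using out_cells[of 0 xs "[False] \<frown> h" "blocks (n # ys) \<frown> w"] assms by simp
  also have "reaches (config (Out K ?r) (rev (blocks xs) \<frown> [False] \<frown> h) (blocks (n # ys) \<frown> w))
      (config (Out K ?r) (replicate n True \<frown> rev (False # blocks xs) \<frown> h) ([False] \<frown> blocks ys \<frown> w))"
    using out_ones[of ?r "rev (False # blocks xs) \<frown> h" n "(False # blocks ys) \<frown> w"] by simp
  also have "reaches (config (Out K ?r) (replicate n True \<frown> rev (False # blocks xs) \<frown> h) ([False] \<frown> blocks ys \<frown> w))
      (config (Back K ?b ?r) (replicate ?n' True \<frown> rev (False # blocks xs) \<frown> h) ([False] \<frown> blocks ys \<frown> w))"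
    unfolding z using act_on_cell[of n z h "blocks ys \<frown> w"] by simp
  also note back_ones[OF order_refl, of ?b ?n' "rev (False # blocks xs) \<frown> h" "[False] \<frown> blocks ys \<frown> w"]
  also have "reaches (config (Back K ?b ?r) (rev (False # blocks xs) \<frown> h) (replicate ?n' True \<frown> [False] \<frown> blocks ys \<frown> w))
      (config (Back K ?b 0) ([False] \<frown> h) (blocks (xs @ ?n' # ys) \<frown> w))"
    using back_cells[of xs ?b h "blocks (?n' # ys) \<frown> w"] assms by simp
  also have "reaches (config (Back K ?b 0) ([False] \<frown> h) (blocks (xs @ ?n' # ys) \<frown> w))
      (config (At (continuation K ?b)) (state_word (Back K ?b 0) \<frown> h) (blocks (xs @ ?n' # ys) \<frown> w))"
    using reaches_step[OF return, of h "blocks (xs @ ?n' # ys) \<frown> w"] by simp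
  finally show "reaches (config (At K) h (blocks (xs @ n # ys) \<frown> w))
    (config (At (continuation K ?b)) (state_word (Back K ?b 0) \<frown> h) (blocks (xs @ ?n' # ys) \<frown> w))"
    using assms by simp
qed

end

definition tape :: "(nat \<Rightarrow> nat) \<Rightarrow> bool list" where
  "tape \<sigma> = blocks (map \<sigma> [0..<N])"

lemma split_registers: "r < N \<Longrightarrow> map \<sigma> [0..<N] = map \<sigma> [0..<r] @ \<sigma> r # map \<sigma> [Suc r..<N]"
  using upt_add_eq_append[of 0 r "N - r"] by (simp add: upt_conv_Cons)

lemma simulates_exec:
  assumes "exec K \<sigma> \<tau>" "K \<in> Q"
  shows "\<exists>h'. reaches (config (At K) h (tape \<sigma> \<frown> w)) (config (At []) h' (tape \<tau> \<frown> w))"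
  using assms
proof (induction arbitrary: h rule: exec.induct)
  case (exec_Nil \<sigma>)
  then show ?case using reaches_refl by blast
next
  case (exec_Cons c K \<sigma> \<tau>)
  let ?r = "reg c" and ?\<sigma>' = "\<sigma>(reg c := update c (\<sigma> (reg c)))"
  have r: "?r < N" using bound[OF exec_Cons.prems] by simp
  have "tape \<sigma> = blocks (map \<sigma> [0..<?r] @ \<sigma> ?r # map \<sigma> [Suc ?r..<N])"
    unfolding tape_def split_registers[OF r] ..
  moreover have "tape ?\<sigma>' = blocks (map \<sigma> [0..<?r] @ update c (\<sigma> ?r) # map \<sigma> [Suc ?r..<N])"
    unfolding tape_def split_registers[OF r] by simp
  ultimately obtain h' where
    "reaches (config (At (c # K)) h (tape \<sigma> \<frown> w))
      (config (At (continuation (c # K) (\<sigma> ?r \<noteq> 0))) h' (tape ?\<sigma>' \<frown> w))"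
    using command_on_cells[of "c # K" "map \<sigma> [0..<?r]" h "\<sigma> ?r" "map \<sigma> [Suc ?r..<N]" w] exec_Cons.prems by auto
  moreover obtain h'' where "reaches (config (At (continuation (c # K) (\<sigma> ?r \<noteq> 0))) h' (tape ?\<sigma>' \<frown> w))
      (config (At []) h'' (tape \<tau> \<frown> w))"
    using exec_Cons.IH closed[OF exec_Cons.prems] by blast
  ultimately show ?case by (blast intro: reaches_trans)
qed

text \<open>
  After \<open>n\<close> steps at least \<open>n\<close> zeros are on top of both stacks, so every digit is
  eventually zero.
\<close>

lemma sink_converges:
  "(\<lambda>n. (f ^^ n) (config (Sink b) l r)) \<longlonglongrightarrow> config (Sink b) (\<lambda>_. False) (\<lambda>_. False)"
proof -
  have iterate: "(f ^^ n) (config (Sink b) l r) = config (Sink b) (replicate n False \<frown> l) (replicate n False \<frown> r)" for n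
  proof (induction n)
    case (Suc n)
    have "((Sink b, [], []), (Sink b, [False], [False])) \<in> machine Q P" unfolding machine_def by simp
    from step[OF this] show ?case using Suc by simp
  qed simp
  have "\<forall>\<^sub>F n in sequentially. (u \<frown> replicate n False \<frown> w) i = (u \<frown> (\<lambda>_. False)) i" for u w i
    using eventually_gt_at_top[of i]
    by eventually_elim (auto simp: conc_def nth_append simp del: conc_conc)
  from this[of "False # state_word (Sink b)"] this[of "[]"] show ?thesis
    unfolding tendsto_cantor_square_iff iterate unfolding config_def by simp
qed

lemma reaches_converges:
  assumes "reaches p p'" "(\<lambda>n. (f ^^ n) p') \<longlonglongrightarrow> q"
  shows "(\<lambda>n. (f ^^ n) p) \<longlonglongrightarrow> q"
proof -
  obtain k where "p' = (f ^^ k) p" using assms(1) unfolding reaches_def by blast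
  with assms(2) have "(\<lambda>n. (f ^^ (n + k)) p) \<longlonglongrightarrow> q" by (simp add: funpow_add)
  then show ?thesis by (rule LIMSEQ_offset)
qed

lemma halting_run_converges:
  assumes "exec P \<sigma> \<tau>"
  shows "(\<lambda>n. (f ^^ n) (config Start h (tape \<sigma> \<frown> w)))
    \<longlonglongrightarrow> config (Sink (\<tau> 0 \<noteq> 0)) (\<lambda>_. False) (\<lambda>_. False)"
proof -
  let ?b = "\<tau> 0 \<noteq> 0"
  have start: "((Start, [], []), (At P, state_word Start, [])) \<in> machine Q P" by (simp add: machine_def)
  have finish: "((At [], [], [?b]), (Sink ?b, [True], [?b])) \<in> machine Q P" by (simp add: machine_def)
  obtain h' where run: "reaches (config (At P) (state_word Start \<frown> h) (tape \<sigma> \<frown> w)) (config (At []) h' (tape \<tau> \<frown> w))"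
    using simulates_exec[OF assms start_in] by blast
  obtain z where z: "tape \<tau> = ?b # z"
    unfolding tape_def split_registers[OF N_pos] by (cases "\<tau> 0") auto
  have "reaches (config Start h (tape \<sigma> \<frown> w)) (config (At P) (state_word Start \<frown> h) (tape \<sigma> \<frown> w))"
    using reaches_step[OF start, of h "tape \<sigma> \<frown> w"] by simp
  also note run
  also have "reaches (config (At []) h' (tape \<tau> \<frown> w)) (config (Sink ?b) ([True] \<frown> h') ([?b] \<frown> z \<frown> w))"
    using reaches_step[OF finish, of h' "z \<frown> w"] z by simp
  finally show ?thesis by (rule reaches_converges) (rule sink_converges)
qed

end

text \<open>
  The command lists met while executing \<open>cs\<close> in front of \<open>K\<close>. There are only finitely
  many, because the remainder of a loop body is always followed by the same loop command.
\<close>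

fun continuations :: "cmd list \<Rightarrow> cmd list \<Rightarrow> cmd list set" where
  "continuations [] K = {K}"
| "continuations (Inc r # cs) K = insert (Inc r # cs @ K) (continuations cs K)"
| "continuations (Dec r # cs) K = insert (Dec r # cs @ K) (continuations cs K)"
| "continuations (While r B # cs) K = continuations B (While r B # cs @ K) \<union> continuations cs K"

lemma finite_continuations: "finite (continuations cs K)"
  by (induction cs K rule: continuations.induct) auto

lemma last_continuation: "K \<in> continuations cs K"
  by (induction cs K rule: continuations.induct) auto

lemma self_continuation: "cs @ K \<in> continuations cs K"
  by (induction cs K rule: continuations.induct) (auto simp: last_continuation)

text \<open>
  The list \<open>K\<close> is excepted, since \<open>cs\<close> is finished when it is reached; for the
  empty \<open>K\<close> nothing is left to be executed at that point.
\<close>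

lemma continuations_closed:
  "X \<in> continuations cs K \<Longrightarrow> X = K \<or> continuation X b \<in> continuations cs K"
proof (induction cs K rule: continuations.induct)
  case (4 r B cs K)
  show ?case
  proof (cases "X \<in> continuations cs K")
    case True
    with 4 show ?thesis by auto
  next
    case False
    with 4 have "X = While r B # cs @ K \<or> continuation X b \<in> continuations B (While r B # cs @ K)"
      by auto
    then show ?thesis
    proof
      assume "X = While r B # cs @ K"
      then show ?thesis
        using self_continuation[of B "While r B # cs @ K"] self_continuation[of cs K]
        by (cases b) auto
    qed auto
  qed
qed (use self_continuation in auto)

definition input_point :: "nat \<Rightarrow> cantor \<times> cantor" where
  "input_point x = config Start (\<lambda>_. False) ((False # replicate x True) \<frown> (\<lambda>_. False))"

definition sink_point :: "bool \<Rightarrow> cantor \<times> cantor" where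
  "sink_point b = config (Sink b) (\<lambda>_. False) (\<lambda>_. False)"

text \<open>
  The argument is in register 1 and the value in register 0. Register 0 is initially
  zero, which accounts for the zero in front of the ones in the input point. Unused registers with value
  zero are blocks without ones, hence part of the infinite tail of zeros.
\<close>

lemma recf_value_decides_limit:
  obtains L f where "describes_element L f" "f \<in> brin_thompson_2V"
    "\<And>x y. computes F [x] y \<Longrightarrow> (\<lambda>n. (f ^^ n) (input_point x)) \<longlonglongrightarrow> sink_point (y \<noteq> 0)"
proof -
  obtain P where P: "evaluates P F [1] 0 2"
    using compilableD[OF recf_compilable, of "[1]" 2 0 F] by auto
  define Q where "Q = continuations P []"
  define N where "N = Suc (Suc (Max (insert 0 ((\<lambda>K. reg (hd K)) ` Q))))"
  have "finite Q" unfolding Q_def by (rule finite_continuations)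
  then obtain L f where Lf: "describes_element L f" "f \<in> brin_thompson_2V"
    "\<And>c d. (c, d) \<in> machine Q P \<Longrightarrow>
      prefix_replacement f (in_copy False (place c)) (in_copy False (place d))"
    using machine_realised_in_2V by metis
  interpret simulation f Q P N
  proof
    fix K assume "K \<in> Q"
    then have "reg (hd K) \<le> Max (insert 0 ((\<lambda>K. reg (hd K)) ` Q))"
      using \<open>finite Q\<close> by (intro Max_ge) auto
    then show "reg (hd K) < N" by (simp add: N_def)
  next
    show "continuation K b \<in> Q" if "K \<in> Q" "K \<noteq> []" for K b
      using continuations_closed[of K P "[]" b] that unfolding Q_def by blast
    show "P \<in> Q" using self_continuation[of P "[]"] by (simp add: Q_def)
  qed (use Lf in \<open>simp_all add: N_def\<close>)
  from Lf(1,2) show thesis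
  proof (rule that)
    fix x y assume "computes F [x] y"
    let ?\<sigma> = "(\<lambda>_. 0)(1 := x)"
    have "ends_in P ?\<sigma> (writes 2 0 y ?\<sigma>)"
      using \<open>computes F [x] y\<close> by (intro evaluatesD[OF P]) simp
    then obtain \<tau> where \<tau>: "exec P ?\<sigma> \<tau>" "\<tau> 0 = y" unfolding ends_in_def writes_def by blast
    \<comment> \<open>the registers from 2 on merge with the tail of zeros\<close>
    have zeros: "replicate n False \<frown> (\<lambda>_. False) = (\<lambda>_. False)" for n
      by (auto simp: fun_eq_iff conc_def)
    obtain M where M: "N = Suc (Suc M)" unfolding N_def by blast
    have "map ?\<sigma> [0..<N] = 0 # x # replicate M 0"
      unfolding M by (rule nth_equalityI) (auto simp: nth_Cons simp del: upt_Suc split: nat.splits)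
    moreover have "blocks (replicate M 0) = replicate M False"
      by (induction M) auto
    ultimately have "tape ?\<sigma> = (False # replicate x True) @ replicate (Suc M) False"
      unfolding tape_def by simp
    then have "tape ?\<sigma> \<frown> (\<lambda>_. False) = (False # replicate x True) \<frown> (\<lambda>_. False)"
      by (simp only: conc_conc[symmetric] zeros)
    then show "(\<lambda>n. (f ^^ n) (input_point x)) \<longlonglongrightarrow> sink_point (y \<noteq> 0)"
      using halting_run_converges[OF \<tau>(1), of "\<lambda>_. False" "\<lambda>_. False"]
      unfolding input_point_def sink_point_def \<tau>(2) by (simp only:)
  qed
qed

section \<open>The diagonal argument\<close>

lemma computes_CompI:
  assumes "length Gs = length ys" "\<And>i. i < length Gs \<Longrightarrow> computes (Gs ! i) xs (ys ! i)" "computes F ys z"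
  shows "computes (Comp F Gs) xs z"
  using assms by (intro comp[of xs Gs ys]) (auto simp: list_all2_conv_all_nth)

lemma computes_Comp1:
  "computes G xs y \<Longrightarrow> computes F [y] z \<Longrightarrow> computes (Comp F [G]) xs z"
  by (rule computes_CompI[of _ "[y]"]) auto

lemma computes_Comp2:
  "computes G xs y \<Longrightarrow> computes H xs y' \<Longrightarrow> computes F [y, y'] z \<Longrightarrow> computes (Comp F [G, H]) xs z"
  by (rule computes_CompI[of _ "[y, y']"]) (auto simp: nth_Cons split: nat.splits)

lemma computes_Proj: "i < length xs \<Longrightarrow> y = xs ! i \<Longrightarrow> computes (Proj i) xs y"
  using proj by blast

fun const_recf :: "nat \<Rightarrow> recf" where
  "const_recf 0 = Zero"
| "const_recf (Suc n) = Comp Succ [const_recf n]"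

lemma computes_const: "computes (const_recf n) xs n"
  by (induction n) (auto intro: zero computes_Comp1 succ)

definition add_recf :: recf where
  "add_recf = PrimRec (Proj 0) (Comp Succ [Proj 1])"

lemma computes_add: "computes add_recf [m, n] (m + n)"
  unfolding add_recf_def
proof (induction m)
  case 0
  show ?case by (simp add: prim_0 computes_Proj)
next
  case (Suc m)
  then show ?case by (auto intro!: prim_Suc computes_Comp1 computes_Proj succ)
qed

definition triangle_recf :: recf where
  "triangle_recf = PrimRec Zero (Comp Succ [Comp add_recf [Proj 0, Proj 1]])"

lemma computes_triangle: "computes triangle_recf [n] (triangle n)"
  unfolding triangle_recf_def
proof (induction n)
  case 0
  show ?case by (simp add: prim_0 zero)
next
  case (Suc n)
  have "computes (Comp Succ [Comp add_recf [Proj 0, Proj 1]]) [n, triangle n] (Suc (n + triangle n))"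
    by (rule computes_Comp1[OF computes_Comp2[OF computes_Proj computes_Proj computes_add] succ]) auto
  with Suc show ?case by (auto intro: prim_Suc simp: add.commute)
qed

definition pair_recf :: recf where
  "pair_recf = Comp add_recf [Comp triangle_recf [add_recf], Proj 0]"

lemma computes_pair: "computes pair_recf [m, n] (prod_encode (m, n))"
  unfolding pair_recf_def prod_encode_def
  by (auto intro!: computes_Comp2[OF _ _ computes_add] computes_Comp1 computes_triangle computes_add computes_Proj)

definition ones_recf :: recf where
  "ones_recf = PrimRec Zero (Comp Succ [Comp pair_recf [const_recf 1, Proj 1]])"

lemma computes_ones: "computes ones_recf [n] (code_word (replicate n True))"
  unfolding ones_recf_def
proof (induction n)
  case 0
  show ?case by (simp add: prim_0 zero code_word_def)
next
  case (Suc n)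
  let ?w = "code_word (replicate n True)"
  have "computes (Comp Succ [Comp pair_recf [const_recf 1, Proj 1]]) [n, ?w] (Suc (prod_encode (1, ?w)))"
    by (rule computes_Comp1[OF computes_Comp2[OF computes_const computes_Proj computes_pair] succ]) auto
  with Suc show ?case by (auto intro: prim_Suc simp: code_word_def)
qed

definition input_word :: "nat \<Rightarrow> bool list \<times> bool list" where
  "input_word x = (False # state_word Start, False # replicate x True)"

definition sink_word :: "bool \<Rightarrow> bool list \<times> bool list" where
  "sink_word b = (False # state_word (Sink b), [])"

lemma describes_input: "describes_point (input_word x) (input_point x)"
  and describes_sink: "describes_point (sink_word b) (sink_point b)"
  by (simp_all add: describes_point_def input_word_def input_point_def sink_word_def sink_point_def config_def)

lemma dyadic_point_described: "describes_point u p \<Longrightarrow> dyadic_point p"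
proof -
  have "finite {n. (w \<frown> (\<lambda>_. False)) n}" for w
    by (rule finite_subset[of _ "{..<length w}"]) (auto simp: conc_def)
  then show "describes_point u p \<Longrightarrow> dyadic_point p"
    by (auto simp: describes_point_def dyadic_point_def)
qed

text \<open>
  The right coordinate of the input point begins with a zero, so that its code is the
  code of a word of ones with one more entry consed to the list.
\<close>

definition self_instance_recf :: recf where
  "self_instance_recf = Comp pair_recf [Proj 0, Comp pair_recf
    [Comp pair_recf [const_recf (code_word (False # state_word Start)),
        Comp Succ [Comp pair_recf [Zero, ones_recf]]],
     const_recf (code_pair (sink_word False))]]"

text \<open>
  From the code of an element alone, the function obtains the code of the instance that asks whether the
  orbit of its own input point converges to the limit for the value zero.
\<close>

lemma computes_self_instance:
  "computes self_instance_recf [code_element L]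
    (code_instance (L, input_word (code_element L), sink_word False))"
proof -
  let ?x = "code_element L"
  have "computes (Comp Succ [Comp pair_recf [Zero, ones_recf]]) [?x] (code_word (False # replicate ?x True))"
    using computes_Comp1[OF computes_Comp2[OF zero computes_ones computes_pair] succ]
    by (simp add: code_word_def)
  then have "computes (Comp pair_recf [const_recf (code_word (False # state_word Start)),
      Comp Succ [Comp pair_recf [Zero, ones_recf]]]) [?x] (code_pair (input_word ?x))"
    unfolding code_pair_def input_word_def fst_conv snd_conv
    by (intro computes_Comp2[OF computes_const _ computes_pair])
  then show ?thesis
    unfolding self_instance_recf_def code_instance_def prod.case
    by (intro computes_Comp2[OF _ computes_Comp2[OF _ computes_const computes_pair] computes_pair]
        computes_Proj) auto
qed

lemma sink_limit_unique:
  assumes "X \<longlonglongrightarrow> sink_point b" "X \<longlonglongrightarrow> sink_point c"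
  shows "b = c"
proof -
  have "\<forall>\<^sub>F n in sequentially. fst (X n) i = fst (sink_point b) i \<and> fst (X n) i = fst (sink_point c) i" for i
    using assms unfolding tendsto_cantor_square_iff by (simp add: eventually_conj)
  then have "fst (sink_point b) i = fst (sink_point c) i" for i
    using eventually_happens'[OF sequentially_bot] by (metis (mono_tags, lifting))
  then have "fst (sink_point b) = fst (sink_point c)" by blast
  then have "compatible (False # state_word (Sink b)) (False # state_word (Sink c))"
    unfolding compatible_def sink_point_def config_def by auto
  then show ?thesis by (simp add: compatible_Cons compatible_code')
qed

theorem theorem6p7:
  shows "\<not> decidable_given code_instance describes_instance
    {(f, p, q). f \<in> brin_thompson_2V \<and> dyadic_point p \<and> dyadic_point q}
    (\<lambda>(f, p, q). (\<lambda>n. (f ^^ n) p) \<longlonglongrightarrow> q)"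
proof
  assume "decidable_given code_instance describes_instance
    {(f, p, q). f \<in> brin_thompson_2V \<and> dyadic_point p \<and> dyadic_point q}
    (\<lambda>(f, p, q). (\<lambda>n. (f ^^ n) p) \<longlonglongrightarrow> q)"
  then obtain A where A: "\<forall>x\<in>{(f, p, q). f \<in> brin_thompson_2V \<and> dyadic_point p \<and> dyadic_point q}.
      \<forall>d. describes_instance d x \<longrightarrow>
        computes A [code_instance d] (if (\<lambda>(f, p, q). (\<lambda>n. (f ^^ n) p) \<longlonglongrightarrow> q) x then 1 else 0)"
    unfolding decidable_given_def by (elim exE)
  have decides: "computes A [code_instance (L, u, v)] (if (\<lambda>n. (f ^^ n) p) \<longlonglongrightarrow> q then 1 else 0)"
    if "f \<in> brin_thompson_2V" "describes_element L f" "describes_point u p" "describes_point v q"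
    for f p q L u v
  proof -
    have "(f, p, q) \<in> {(f, p, q). f \<in> brin_thompson_2V \<and> dyadic_point p \<and> dyadic_point q}"
      using that(1) dyadic_point_described[OF that(3)] dyadic_point_described[OF that(4)] by simp
    from A[rule_format, OF this, of "(L, u, v)"] show ?thesis
      using that by (simp add: describes_instance_def)
  qed
  obtain L f where L: "describes_element L f" and f: "f \<in> brin_thompson_2V"
    and limit: "\<And>x y. computes (Comp A [self_instance_recf]) [x] y \<Longrightarrow>
      (\<lambda>n. (f ^^ n) (input_point x)) \<longlonglongrightarrow> sink_point (y \<noteq> 0)"
    using recf_value_decides_limit[of "Comp A [self_instance_recf]"] by metis
  define x where "x = code_element L"
  let ?converges = "(\<lambda>n. (f ^^ n) (input_point x)) \<longlonglongrightarrow> sink_point False"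
  have "computes (Comp A [self_instance_recf]) [x] (if ?converges then 1 else 0)"
    using computes_Comp1[OF computes_self_instance decides[OF f L describes_input describes_sink]]
    by (simp add: x_def)
  \<comment> \<open>a positive answer is the value 1, whose limit is the other point\<close>
  from limit[OF this] have "(\<lambda>n. (f ^^ n) (input_point x)) \<longlonglongrightarrow> sink_point ?converges"
    by (simp split: if_splits)
  then show False by (metis sink_limit_unique)
qed

end
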